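(* Let $k\geq1$ be an integer and let $\mathbf{P}=(p_{ij})_{i,j\in\{0,1\}}$ be a $2\times 2$ stochastic matrix with $p_{01}+p_{10}>0$. Reconstruction is impossible (for $\mathbf{P}$ and $k$) whenever $$\Big(\sqrt{p_{00}p_{11}}-\sqrt{p_{01}p_{10}}\Big)^2\leq\frac{1}{k}.$$
   Context: $\mathbb{T}^k$ denotes the infinite rooted tree in which every node has exactly $k$ children. A $2\times2$ stochastic matrix $\mathbf{P}=(p_{ij})_{i,j\in\{0,1\}}$ (nonnegative entries, each row summing to $1$) is regarded as a transition matrix on $\{0,1\}$. Put $\pi_0=p_{10}/(p_{01}+p_{10})$ and $\pi_1=1-\pi_0$ (the stationary distribution of $\mathbf{P}$). Branching random walk: a random configuration $\phi=\{\phi(u),u\in\mathbb{T}^k\}\in\{0,1\}^{\mathbb{T}^k}$ is generated as follows. The root takes value $0$ with probability $\pi_0$ and value $1$ with probability $\pi_1$. Recursively, if a node has value $i$, each of its $k$ children takes value $0$ with probability $p_{i0}$ and value $1$ with probability $p_{i1}$, all choices being made independently. Let $\mu$ be the law of $\phi$ on $\{0,1\}^{\mathbb{T}^k}$. For a node $u$ and $d\geq1$, let $\mathbb{W}_d(u)$ be the set of descendants of $u$ at distance exactly $d$ from $u$. For $S\subseteq\mathbb{T}^k$, $\sigma(S)$ is the $\sigma$-algebra generated by $\{\phi(v),v\in S\}$. Let $$\mathcal{T}(u)=\bigcap_{d=1}^\infty\sigma\Big(\bigcup_{d'=d}^\infty\mathbb{W}_{d'}(u)\Big),\qquad A(u)=\mu(\phi(u)=0\mid\mathcal{T}(u)).$$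 The distribution of $A(u)$ is the same for all $u\in\mathbb{T}^k$. For given $\mathbf{P}$ and $k$, reconstruction is said to be impossible if the random variable $A(u)$ is $\mu$-almost surely constant, and possible otherwise.
   Formalization: The case k = 1 with p01 = p10 = 1 is excluded: there the inequality holds (1 ≤ 1), but the values alternate along the single ray, so the tail determines φ(u), A(u) is 0 or 1 with probability 1/2 each, and reconstruction is possible. *)

theory Defs
  imports "HOL-Probability.Probability"
begin

text \<open>
  The two values are the elements \<open>0\<close> and \<open>1\<close> of the library type \<open>2\<close> of integers modulo two,
  so that \<open>P $ i $ j\<close> is the entry in row \<open>i\<close> and column \<open>j\<close>.
\<close>

lemma UNIV_2_eq: "(UNIV :: 2 set) = {0, 1}"
  using UNIV_2 by auto

lemma forall_2_iff: "(\<forall>i::2. Q i) \<longleftrightarrow> Q 0 \<and> Q 1"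
  by (metis UNIV_2_eq UNIV_I empty_iff insert_iff)

definition stochastic :: "real^2^2 \<Rightarrow> bool" where
  "stochastic P \<longleftrightarrow> (\<forall>i j. 0 \<le> P $ i $ j) \<and> (\<forall>i. (\<Sum>j\<in>UNIV. P $ i $ j) = 1)"

definition stationary :: "real^2^2 \<Rightarrow> 2 \<Rightarrow> real" where
  "stationary P i =
     (let \<pi>\<^sub>0 = P $ 1 $ 0 / (P $ 0 $ 1 + P $ 1 $ 0) in if i = 0 then \<pi>\<^sub>0 else 1 - \<pi>\<^sub>0)"

text \<open>
  The functions embedded here are probability mass functions under the standing assumptions; see
  \<open>pmf_row_pmf\<close> and \<open>pmf_init_pmf\<close> below.
\<close>

definition row_pmf :: "real^2^2 \<Rightarrow> 2 \<Rightarrow> 2 pmf" where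
  "row_pmf P i = embed_pmf (\<lambda>j. P $ i $ j)"

definition init_pmf :: "real^2^2 \<Rightarrow> 2 pmf" where
  "init_pmf P = embed_pmf (stationary P)"

text \<open>
  A node of the \<open>k\<close>-ary tree is the path leading to it from the root, most recent step first: the
  root is \<open>[]\<close> and the children of \<open>u\<close> are the nodes \<open>c # u\<close> with \<open>c < k\<close>.
\<close>

definition tree :: "nat \<Rightarrow> nat list set" where
  "tree k = {u. set u \<subseteq> {..<k}}"

definition descendants :: "nat \<Rightarrow> nat \<Rightarrow> nat list \<Rightarrow> nat list set" where
  "descendants k d u = {w @ u | w. w \<in> tree k \<and> length w = d}"

definition configs :: "nat \<Rightarrow> (nat list \<Rightarrow> 2) measure" where
  "configs k = PiM (tree k) (\<lambda>_. count_space UNIV)"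

text \<open>
  The randomness driving the walk: the value \<open>r\<close> of the root, and independently for each node \<open>v\<close>
  and each \<open>i\<close> the value \<open>\<xi> (v, i)\<close>, distributed according to row \<open>i\<close> of \<open>P\<close>, which \<open>v\<close> takes if
  its parent has value \<open>i\<close>. (The variables \<open>\<xi> ([], i)\<close> are not used.)
\<close>

definition noise :: "nat \<Rightarrow> real^2^2 \<Rightarrow> (2 \<times> (nat list \<times> 2 \<Rightarrow> 2)) measure" where
  "noise k P = measure_pmf (init_pmf P) \<Otimes>\<^sub>M
     PiM (tree k \<times> UNIV) (\<lambda>(v, i). measure_pmf (row_pmf P i))"

primrec grow :: "2 \<Rightarrow> (nat list \<times> 2 \<Rightarrow> 2) \<Rightarrow> nat list \<Rightarrow> 2" where
  "grow r \<xi> [] = r"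
| "grow r \<xi> (c # u) = \<xi> (c # u, grow r \<xi> u)"

definition brw :: "nat \<Rightarrow> real^2^2 \<Rightarrow> (nat list \<Rightarrow> 2) measure" where
  "brw k P = distr (noise k P) (configs k) (\<lambda>(r, \<xi>). restrict (grow r \<xi>) (tree k))"

definition sigma_gen :: "nat \<Rightarrow> nat list set \<Rightarrow> (nat list \<Rightarrow> 2) set set" where
  "sigma_gen k S = sigma_sets (space (configs k))
     {(\<lambda>\<phi>. \<phi> v) -` B \<inter> space (configs k) | v B. v \<in> S}"

definition tail :: "nat \<Rightarrow> nat list \<Rightarrow> (nat list \<Rightarrow> 2) measure" where
  "tail k u = sigma (space (configs k))
     (\<Inter>d\<in>{1..}. sigma_gen k (\<Union>d'\<in>{d..}. descendants k d' u))"

definition posterior :: "nat \<Rightarrow> real^2^2 \<Rightarrow> nat list \<Rightarrow> (nat list \<Rightarrow> 2) \<Rightarrow> real" where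
  "posterior k P u =
     real_cond_exp (brw k P) (tail k u) (indicator {\<phi> \<in> space (brw k P). \<phi> u = 0})"

text \<open>
  For \<open>k = 1\<close> and \<open>P $ 0 $ 1 = P $ 1 $ 0 = 1\<close> the values along the single ray alternate, so the tail
  determines the value of \<open>u\<close>, which is uniformly distributed: here \<open>posterior k P u\<close> is almost surely
  the indicator of \<open>\<phi> u = 0\<close>, and reconstruction is possible.
\<close>

definition reconstruction_impossible :: "nat \<Rightarrow> real^2^2 \<Rightarrow> bool" where
  "reconstruction_impossible k P \<longleftrightarrow>
     (\<forall>u\<in>tree k. \<exists>c. AE \<phi> in brw k P. posterior k P u \<phi> = c)"

lemma stationary_bounds:
  assumes "stochastic P" "P $ 0 $ 1 + P $ 1 $ 0 > 0"
  shows "0 \<le> stationary P i"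
proof -
  have "P $ 0 $ 1 \<ge> 0" "P $ 1 $ 0 \<ge> 0"
    using assms(1) by (auto simp: stochastic_def)
  with assms(2) show ?thesis
    by (auto simp: stationary_def Let_def field_simps)
qed

lemma nn_integral_2:
  fixes f :: "2 \<Rightarrow> real"
  assumes "\<And>i. 0 \<le> f i" "f 0 + f 1 = 1"
  shows "(\<integral>\<^sup>+ i. ennreal (f i) \<partial>count_space UNIV) = 1"
proof -
  have "(\<integral>\<^sup>+ i. ennreal (f i) \<partial>count_space UNIV) = (\<Sum>i\<in>UNIV. ennreal (f i))"
    by (rule nn_integral_count_space_finite) simp
  also have "\<dots> = ennreal (\<Sum>i\<in>UNIV. f i)"
    by (rule sum_ennreal) (use assms in auto)
  also have "(\<Sum>i\<in>UNIV. f i) = 1"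
    using assms(2) by (simp add: UNIV_2_eq)
  finally show ?thesis by simp
qed

lemma pmf_row_pmf:
  assumes "stochastic P"
  shows "pmf (row_pmf P i) j = P $ i $ j"
  unfolding row_pmf_def
proof (rule pmf_embed_pmf)
  show "0 \<le> P $ i $ j" for j
    using assms by (simp add: stochastic_def)
  have "(\<Sum>j\<in>UNIV. P $ i $ j) = 1"
    using assms by (simp add: stochastic_def)
  then have "P $ i $ 0 + P $ i $ 1 = 1"
    by (simp add: UNIV_2_eq)
  then show "(\<integral>\<^sup>+ j. ennreal (P $ i $ j) \<partial>count_space UNIV) = 1"
    by (intro nn_integral_2) (use assms in \<open>auto simp: stochastic_def\<close>)
qed

lemma pmf_init_pmf:
  assumes "stochastic P" "P $ 0 $ 1 + P $ 1 $ 0 > 0"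
  shows "pmf (init_pmf P) i = stationary P i"
  unfolding init_pmf_def
  by (rule pmf_embed_pmf)
     (use stationary_bounds[OF assms] in \<open>auto intro!: nn_integral_2 simp: stationary_def Let_def\<close>)

lemma Nil_in_tree [simp]: "[] \<in> tree k"
  by (simp add: tree_def)

lemma Cons_in_tree [simp]: "c # u \<in> tree k \<longleftrightarrow> c < k \<and> u \<in> tree k"
  by (auto simp: tree_def)

lemma append_in_tree [simp]: "u @ v \<in> tree k \<longleftrightarrow> u \<in> tree k \<and> v \<in> tree k"
  by (auto simp: tree_def)

lemma prob_space_noise: "prob_space (noise k P)"
proof -
  interpret N: prob_space "PiM (tree k \<times> UNIV) (\<lambda>(v, i). measure_pmf (row_pmf P i))"
    by (rule prob_space_PiM) (auto intro: measure_pmf.prob_space_axioms)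
  interpret pair_prob_space "measure_pmf (init_pmf P)"
    "PiM (tree k \<times> UNIV) (\<lambda>(v, i). measure_pmf (row_pmf P i))" ..
  show ?thesis
    unfolding noise_def by (rule prob_space_axioms)
qed

lemma measurable_grow:
  assumes "u \<in> tree k"
  shows "(\<lambda>(r, \<xi>). grow r \<xi> u) \<in> measurable (noise k P) (count_space UNIV)"
  using assms
proof (induction u)
  case Nil
  show ?case
    unfolding noise_def by (simp add: case_prod_unfold)
next
  case (Cons c u)
  have comp: "(\<lambda>\<omega>. snd \<omega> (c # u, i)) \<in> measurable (noise k P) (count_space UNIV)" for i
  proof -
    have "(\<lambda>\<xi>. \<xi> (c # u, i)) \<in> measurable
        (PiM (tree k \<times> UNIV) (\<lambda>(v, i). measure_pmf (row_pmf P i)))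
        ((\<lambda>(v, i). measure_pmf (row_pmf P i)) (c # u, i))"
      by (rule measurable_component_singleton) (use Cons.prems in auto)
    then have "(\<lambda>\<xi>. \<xi> (c # u, i)) \<in> measurable
        (PiM (tree k \<times> UNIV) (\<lambda>(v, i). measure_pmf (row_pmf P i))) (count_space UNIV)"
      by simp
    from measurable_compose[OF measurable_snd this] show ?thesis
      unfolding noise_def .
  qed
  have "(\<lambda>\<omega>. grow (fst \<omega>) (snd \<omega>) u) \<in> measurable (noise k P) (count_space UNIV)"
    using Cons by (simp add: case_prod_unfold)
  then have "(\<lambda>\<omega>. snd \<omega> (c # u, grow (fst \<omega>) (snd \<omega>) u))
      \<in> measurable (noise k P) (count_space UNIV)"
    by (rule measurable_compose_countable[OF comp, rotated])
  then show ?case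
    by (simp add: case_prod_unfold)
qed

lemma measurable_restrict_grow:
  "(\<lambda>(r, \<xi>). restrict (grow r \<xi>) (tree k)) \<in> measurable (noise k P) (configs k)"
  unfolding configs_def case_prod_unfold
  by (rule measurable_restrict) (use measurable_grow in \<open>simp add: case_prod_unfold\<close>)

lemma prob_space_brw: "prob_space (brw k P)"
  unfolding brw_def
  by (rule prob_space.prob_space_distr[OF prob_space_noise measurable_restrict_grow])

lemma space_brw [simp]: "space (brw k P) = space (configs k)"
  and sets_brw [simp]: "sets (brw k P) = sets (configs k)"
  by (simp_all add: brw_def)

lemma brw_cylinder:
  assumes P: "stochastic P" "P $ 0 $ 1 + P $ 1 $ 0 > 0"
    and S: "finite S" "S \<subseteq> tree k" "[] \<in> S" "\<And>c u. c # u \<in> S \<Longrightarrow> u \<in> S"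
  shows "measure (brw k P) {\<phi> \<in> space (brw k P). \<forall>v\<in>S. \<phi> v = x v} =
    stationary P (x []) * (\<Prod>v\<in>S - {[]}. P $ x (tl v) $ x v)"
proof -
  define R where "R = (\<lambda>(v :: nat list, i). measure_pmf (row_pmf P i))"
  define J where "J = (\<lambda>v. (v, x (tl v))) ` (S - {[]})"
  define B where "B = prod_emb (tree k \<times> UNIV) R J (Pi\<^sub>E J (\<lambda>(v, i). {x v}))"
  interpret R: product_prob_space R "tree k \<times> UNIV"
    by (intro product_prob_spaceI) (auto simp: R_def intro: measure_pmf.prob_space_axioms)
  have J: "finite J" "J \<subseteq> tree k \<times> UNIV"
    using S by (auto simp: J_def)
  have inj: "inj_on (\<lambda>v. (v, x (tl v))) (S - {[]})"
    by (auto simp: inj_on_def)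
  have noise: "noise k P = measure_pmf (init_pmf P) \<Otimes>\<^sub>M PiM (tree k \<times> UNIV) R"
    by (simp add: noise_def R_def)
  have sets_B: "B \<in> sets (PiM (tree k \<times> UNIV) R)"
    unfolding B_def by (intro sets_PiM_I J) (auto simp: R_def)
  have meas_cyl: "{\<phi> \<in> space (configs k). \<forall>v\<in>S. \<phi> v = x v} \<in> sets (configs k)"
  proof -
    have "{\<phi> \<in> space (configs k). \<phi> v = x v} \<in> sets (configs k)" if "v \<in> S" for v
    proof -
      have "v \<in> tree k"
        using that S(2) by blast
      then have "(\<lambda>\<phi>. \<phi> v) \<in> measurable (configs k) (count_space UNIV)"
        unfolding configs_def by (rule measurable_component_singleton)
      then have "(\<lambda>\<phi>. \<phi> v) -` {x v} \<inter> space (configs k) \<in> sets (configs k)"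
        by (rule measurable_sets) simp
      moreover have "(\<lambda>\<phi>. \<phi> v) -` {x v} \<inter> space (configs k) = {\<phi> \<in> space (configs k). \<phi> v = x v}"
        by blast
      ultimately show ?thesis by simp
    qed
    then show ?thesis
      using S(1) by (intro sets.sets_Collect_finite_All)
  qed
  have iff: "(\<forall>v\<in>S. grow r \<xi> v = x v) \<longleftrightarrow>
      r = x [] \<and> (\<forall>v\<in>S - {[]}. \<xi> (v, x (tl v)) = x v)" for r \<xi>
  proof (intro iffI conjI ballI; (elim conjE)?)
    assume *: "\<forall>v\<in>S. grow r \<xi> v = x v"
    show "r = x []" using bspec[OF * S(3)] by simp
    fix v assume v: "v \<in> S - {[]}"
    then obtain c u where cu: "v = c # u"
      by (cases v) auto
    with v have "c # u \<in> S" "u \<in> S"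
      using S(4) by auto
    with * have "grow r \<xi> (c # u) = x (c # u)" "grow r \<xi> u = x u"
      by (blast, blast)
    then show "\<xi> (v, x (tl v)) = x v"
      by (simp add: cu)
  next
    fix v assume r: "r = x []" and *: "\<forall>v\<in>S - {[]}. \<xi> (v, x (tl v)) = x v" and "v \<in> S"
    from \<open>v \<in> S\<close> show "grow r \<xi> v = x v"
    proof (induction v)
      case (Cons c u)
      have "grow r \<xi> u = x u"
        using Cons.IH S(4)[OF Cons.prems] by blast
      moreover have "\<xi> (c # u, x u) = x (c # u)"
        using bspec[OF *, of "c # u"] Cons.prems by simp
      ultimately show ?case by simp
    qed (simp add: r)
  qed
  have pre: "(\<lambda>(r, \<xi>). restrict (grow r \<xi>) (tree k)) -`
      {\<phi> \<in> space (configs k). \<forall>v\<in>S. \<phi> v = x v} \<inter> space (noise k P) = {x []} \<times> B"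
    (is "?L = ?R")
  proof -
    have "(r, \<xi>) \<in> ?L \<longleftrightarrow> (r, \<xi>) \<in> ?R" for r \<xi>
    proof -
      have "(r, \<xi>) \<in> ?L \<longleftrightarrow> \<xi> \<in> space (PiM (tree k \<times> UNIV) R) \<and> (\<forall>v\<in>S. grow r \<xi> v = x v)"
        using S(2) by (auto simp: noise space_pair_measure configs_def space_PiM subset_eq)
      also have "\<dots> \<longleftrightarrow> (r, \<xi>) \<in> ?R"
        unfolding iff by (auto simp: B_def prod_emb_def J_def space_PiM PiE_iff)
      finally show ?thesis .
    qed
    from this[of "fst \<omega>" "snd \<omega>" for \<omega>] show ?thesis
      unfolding prod.collapse by (rule set_eqI)
  qed
  have "emeasure (brw k P) {\<phi> \<in> space (configs k). \<forall>v\<in>S. \<phi> v = x v} =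
      emeasure (noise k P) ({x []} \<times> B)"
    unfolding brw_def
    by (subst emeasure_distr[OF measurable_restrict_grow meas_cyl]) (simp only: pre)
  also have "\<dots> = emeasure (measure_pmf (init_pmf P)) {x []} * emeasure (PiM (tree k \<times> UNIV) R) B"
    unfolding noise using sets_B by (intro R.emeasure_pair_measure_Times) auto
  also have "emeasure (PiM (tree k \<times> UNIV) R) B =
      (\<Prod>j\<in>J. emeasure (R j) ((\<lambda>(v, i). {x v}) j))"
    unfolding B_def by (intro R.emeasure_PiM_emb J) (auto simp: R_def)
  also have "\<dots> = (\<Prod>v\<in>S - {[]}. emeasure (measure_pmf (row_pmf P (x (tl v)))) {x v})"
    unfolding J_def by (subst prod.reindex[OF inj]) (simp add: R_def)
  also have "\<dots> = ennreal (\<Prod>v\<in>S - {[]}. P $ x (tl v) $ x v)"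
    using P(1) by (simp add: emeasure_pmf_single pmf_row_pmf prod_ennreal stochastic_def)
  also have "emeasure (measure_pmf (init_pmf P)) {x []} = ennreal (stationary P (x []))"
    by (simp add: emeasure_pmf_single pmf_init_pmf[OF P])
  also have "ennreal (stationary P (x [])) * ennreal (\<Prod>v\<in>S - {[]}. P $ x (tl v) $ x v) =
      ennreal (stationary P (x []) * (\<Prod>v\<in>S - {[]}. P $ x (tl v) $ x v))"
    by (simp add: ennreal_mult' stationary_bounds[OF P])
  finally show ?thesis
    using P(1) stationary_bounds[OF P]
    by (simp add: measure_def prod_nonneg stochastic_def)
qed

lemma sigma_gen_subset:
  assumes "S \<subseteq> tree k"
  shows "sigma_gen k S \<subseteq> sets (configs k)"
proof -
  have "(\<lambda>\<phi>. \<phi> v) -` B \<inter> space (configs k) \<in> sets (configs k)" if "v \<in> S" for v and B :: "2 set"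
  proof -
    have "(\<lambda>\<phi>. \<phi> v) \<in> measurable (configs k) (count_space UNIV)"
      using that assms unfolding configs_def by (intro measurable_component_singleton) auto
    then show ?thesis by (rule measurable_sets) simp
  qed
  then show ?thesis
    unfolding sigma_gen_def by (intro sets.sigma_sets_subset) auto
qed

lemma sigma_algebra_sigma_gen: "sigma_algebra (space (configs k)) (sigma_gen k S)"
  unfolding sigma_gen_def by (rule sigma_algebra_sigma_sets) auto

lemma descendants_subset: "u \<in> tree k \<Longrightarrow> descendants k d u \<subseteq> tree k"
  by (auto simp: descendants_def)

lemma space_tail [simp]: "space (tail k u) = space (configs k)"
  by (simp add: tail_def space_measure_of_conv)

lemma sets_tail:
  "sets (tail k u) = (\<Inter>d\<in>{1..}. sigma_gen k (\<Union>d'\<in>{d..}. descendants k d' u))" (is "_ = ?I")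
proof -
  let ?G = "\<lambda>d. sigma_gen k (\<Union>d'\<in>{d..}. descendants k d' u)"
  have "?G 1 \<subseteq> Pow (space (configs k))"
    using sigma_algebra.axioms(1)[OF sigma_algebra_sigma_gen] algebra.axioms(1)
      ring_of_sets.axioms(1) semiring_of_sets.axioms(1) subset_class.space_closed by metis
  then have "?I \<subseteq> Pow (space (configs k))"
    by (rule order_trans[rotated]) (rule INT_lower, simp)
  then have "sets (tail k u) = sigma_sets (space (configs k)) ?I"
    unfolding tail_def by (rule sets_measure_of)
  also have "\<dots> = ?I"
  proof
    show "sigma_sets (space (configs k)) ?I \<subseteq> ?I"
    proof (rule INT_greatest)
      fix d :: nat assume "d \<in> {1..}"
      then have "?I \<subseteq> ?G d"
        by (rule INT_lower)
      then show "sigma_sets (space (configs k)) ?I \<subseteq> ?G d"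
        by (rule sigma_algebra.sigma_sets_subset[OF sigma_algebra_sigma_gen])
    qed
  qed (rule sigma_sets_superset_generator)
  finally show ?thesis .
qed

lemma subalgebra_tail:
  assumes "u \<in> tree k"
  shows "subalgebra (brw k P) (tail k u)"
proof -
  have "sets (tail k u) \<subseteq> sigma_gen k (\<Union>d'\<in>{1..}. descendants k d' u)"
    by (auto simp: sets_tail)
  also have "\<dots> \<subseteq> sets (configs k)"
    using descendants_subset[OF assms] by (intro sigma_gen_subset) blast
  finally show ?thesis
    by (simp add: subalgebra_def)
qed

end

theory Submission
  imports Defs
begin

text \<open>
  Let \<open>q\<^sub>n i\<close> be the law of the values on level \<open>n\<close> below a node with value \<open>i\<close>. A tail event is
  observable from every level on, and given the values on level \<open>n\<close> it does not depend on the
  value of the node; so its two conditional probabilities given the value of the node differ by at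
  most the \<open>L\<^sup>1\<close> distance of \<open>q\<^sub>n 0\<close> and \<open>q\<^sub>n 1\<close> (\<open>tail_event_markov\<close>,
  \<open>tail_event_dependence\<close>). If this distance becomes arbitrarily small, then the node is independent of
  its tail \<open>\<sigma>\<close>-algebra, and the posterior is the constant \<open>\<pi>\<^sub>0\<close> (\<open>posterior_const\<close>).

  That the two laws merge is shown with their symmetrised Kullback--Leibler divergence
  \<open>J\<^sub>n = \<Sum>\<^sub>x (q\<^sub>n 0 x - q\<^sub>n 1 x) (ln (q\<^sub>n 0 x) - ln (q\<^sub>n 1 x))\<close>. It is additive over independent
  components (\<open>sym_divergence_tensor\<close>), so \<open>J\<^sub>n\<^sub>+\<^sub>1\<close> is \<open>k\<close> times the divergence of the two
  mixtures of \<open>q\<^sub>n 0\<close> and \<open>q\<^sub>n 1\<close> with weights from the rows of \<open>P\<close>. With the likelihood ratio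
  \<open>r = q\<^sub>n 0 / q\<^sub>n 1\<close> this gives
  \<open>J\<^sub>n - J\<^sub>n\<^sub>+\<^sub>1 = E [(r - 1) G r]\<close>, where the mean is taken under \<open>q\<^sub>n 1\<close> and
  \<open>G r = ln r - k (p\<^sub>0\<^sub>0 - p\<^sub>1\<^sub>0) ln ((p\<^sub>0\<^sub>0 r + p\<^sub>0\<^sub>1) / (p\<^sub>1\<^sub>0 r + p\<^sub>1\<^sub>1))\<close>
  (\<open>level_divergence_drop\<close>). The hypothesis on \<open>P\<close> and \<open>k\<close> makes \<open>G\<close> strictly increasing, even in
  the case of equality (\<open>log_likelihood_gain_strict_mono\<close>), and \<open>G 1 = 0\<close>. Hence the
  decrements of the nonnegative sequence \<open>J\<close> are nonnegative and come arbitrarily close to zero, which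
  forces \<open>r\<close> to be close to \<open>1\<close> with high probability (\<open>level_laws_merge\<close>).

  This needs both off-diagonal entries and at least one diagonal entry of \<open>P\<close> to be positive. If an
  off-diagonal entry vanishes, then the stationary walk is almost surely constant, and independence is
  trivial. If both diagonal entries vanish, then the threshold leaves only \<open>k = 1\<close>, which is the
  excluded alternating walk.
\<close>

section \<open>Monotonicity of the gain in log-likelihood\<close>

text \<open>
  Passing one edge of the tree turns a likelihood ratio \<open>t\<close> into \<open>(a t + b) / (c t + d)\<close>. The
  function here is \<open>ln t\<close> minus \<open>\<kappa> (a - c)\<close> times the logarithm of the new ratio, and its
  derivative is \<open>1 / t - \<kappa> (a - c)\<^sup>2 / ((a t + b) (c t + d))\<close>. Since the rows sum to one,
  \<open>a - c = a d - b c\<close>, which factors as the product of \<open>\<surd>(a d) - \<surd>(b c)\<close> and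
  \<open>\<surd>(a d) + \<surd>(b c)\<close>; so the threshold bounds \<open>\<kappa> (a - c)\<^sup>2\<close> by
  \<open>(\<surd>(a d) + \<surd>(b c))\<^sup>2\<close>. Completing the square,
  \<open>(a t + b) (c t + d) = (\<surd>(a d) + \<surd>(b c))\<^sup>2 t + (\<surd>(a c) t - \<surd>(b d))\<^sup>2\<close>,
  hence the derivative is nonnegative and vanishes for at most one \<open>t\<close>. For the periodic chain
  \<open>a = d = 0\<close> the last square vanishes identically, and with \<open>\<kappa> = 1\<close> the function is constant.
\<close>
lemma log_likelihood_gain_strict_mono:
  fixes a b c d \<kappa> r s :: real
  assumes rows: "a + b = 1" "c + d = 1" and nonneg: "0 \<le> a" "0 < b" "0 < c" "0 \<le> d"
    and aperiodic: "0 < a \<or> 0 < d"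
    and threshold: "\<kappa> * (sqrt (a * d) - sqrt (b * c))\<^sup>2 \<le> 1"
    and rs: "0 < r" "r < s"
  shows "ln r - \<kappa> * (a - c) * (ln (a * r + b) - ln (c * r + d))
       < ln s - \<kappa> * (a - c) * (ln (a * s + b) - ln (c * s + d))"
proof -
  define G where "G = (\<lambda>t. ln t - \<kappa> * (a - c) * (ln (a * t + b) - ln (c * t + d)))"
  define G' where "G' = (\<lambda>t. 1 / t - \<kappa> * (a - c) * (a / (a * t + b) - c / (c * t + d)))"
  have pos: "0 < a * t + b" "0 < c * t + d" if "0 < t" for t
    using that nonneg by (simp_all add: add_nonneg_pos add_pos_nonneg)
  have deriv: "(G has_real_derivative G' t) (at t)" if "0 < t" for t
  proof -
    have "((\<lambda>t. ln (a * t + b)) has_real_derivative a / (a * t + b)) (at t)"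
      "((\<lambda>t. ln (c * t + d)) has_real_derivative c / (c * t + d)) (at t)"
      using pos[OF that] by (auto intro!: derivative_eq_intros)
    from DERIV_diff[OF DERIV_ln_divide[OF that] DERIV_cmult[OF DERIV_diff[OF this]]]
    show ?thesis unfolding G_def G'_def .
  qed
  define S where "S = (sqrt (a * d) + sqrt (b * c))\<^sup>2"
  have roots: "sqrt (a * d) * sqrt (a * d) = a * d" "sqrt (b * c) * sqrt (b * c) = b * c"
    "sqrt (a * c) * sqrt (a * c) = a * c" "sqrt (b * d) * sqrt (b * d) = b * d"
    using nonneg by simp_all
  have cross: "sqrt (a * d) * sqrt (b * c) = sqrt (a * c) * sqrt (b * d)"
    by (simp add: real_sqrt_mult)
  have det: "a - c = a * d - b * c"
    using rows by algebra
  have "a - c = (sqrt (a * d) - sqrt (b * c)) * (sqrt (a * d) + sqrt (b * c))"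
    unfolding det using roots by (simp add: algebra_simps del: real_sqrt_mult_self)
  then have "\<kappa> * (a - c)\<^sup>2 = \<kappa> * (sqrt (a * d) - sqrt (b * c))\<^sup>2 * S"
    by (simp add: S_def power_mult_distrib)
  also have "\<dots> \<le> 1 * S"
    by (intro mult_right_mono threshold) (simp add: S_def)
  finally have kS: "\<kappa> * (a - c)\<^sup>2 \<le> S" by simp
  have lower: "(sqrt (a * c) * t - sqrt (b * d))\<^sup>2 / (t * ((a * t + b) * (c * t + d))) \<le> G' t"
    if t: "0 < t" for t
  proof -
    have split: "(a * t + b) * (c * t + d) = S * t + (sqrt (a * c) * t - sqrt (b * d))\<^sup>2"
    proof -
      have "S * t + (sqrt (a * c) * t - sqrt (b * d))\<^sup>2 =
        (sqrt (a * d) * sqrt (a * d) + sqrt (b * c) * sqrt (b * c)) * t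
        + 2 * (sqrt (a * d) * sqrt (b * c)) * t
        + (sqrt (a * c) * sqrt (a * c)) * t\<^sup>2 + sqrt (b * d) * sqrt (b * d)
        - 2 * (sqrt (a * c) * sqrt (b * d)) * t"
        by (simp add: S_def power2_eq_square algebra_simps del: real_sqrt_mult_self)
      also have "\<dots> = (a * d + b * c) * t + a * c * t\<^sup>2 + b * d"
        by (simp only: roots cross)
      also have "\<dots> = (a * t + b) * (c * t + d)"
        by (simp add: power2_eq_square algebra_simps)
      finally show ?thesis by simp
    qed
    have "G' t = 1 / t - \<kappa> * (a - c) * ((a * d - b * c) / ((a * t + b) * (c * t + d)))"
      unfolding G'_def using pos[OF t] by (simp add: field_simps)
    also have "\<dots> = ((a * t + b) * (c * t + d) - \<kappa> * (a - c)\<^sup>2 * t)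
        / (t * ((a * t + b) * (c * t + d)))"
      unfolding det[symmetric] using pos[OF t] t
      by (simp add: divide_simps power2_eq_square)
    also have "\<dots> \<ge> (sqrt (a * c) * t - sqrt (b * d))\<^sup>2 / (t * ((a * t + b) * (c * t + d)))"
    proof (rule divide_right_mono)
      show "(sqrt (a * c) * t - sqrt (b * d))\<^sup>2
          \<le> (a * t + b) * (c * t + d) - \<kappa> * (a - c)\<^sup>2 * t"
        unfolding split using mult_right_mono[OF kS, of t] t by simp
    qed (use t pos[OF t] in simp)
    finally show ?thesis .
  qed
  have G'_nonneg: "0 \<le> G' t" if "0 < t" for t
    by (rule order_trans[OF _ lower[OF that]]) (use pos[OF that] that in simp)
  have G'_zero: "sqrt (a * c) * t = sqrt (b * d)" if "0 < t" "G' t = 0" for t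
  proof (rule ccontr)
    assume "sqrt (a * c) * t \<noteq> sqrt (b * d)"
    then have "0 < (sqrt (a * c) * t - sqrt (b * d))\<^sup>2 / (t * ((a * t + b) * (c * t + d)))"
      using pos[OF that(1)] that(1) by simp
    with lower[OF that(1)] that(2) show False by simp
  qed
  have not_both: False if "0 < t" "t < t'" "G' t = 0" "G' t' = 0" for t t'
  proof -
    have "sqrt (a * c) * t = sqrt (a * c) * t'" "sqrt (a * c) * t = sqrt (b * d)"
      using G'_zero[of t] G'_zero[of t'] that by simp_all
    with that(2) nonneg have "a = 0" "d = 0" by auto
    with aperiodic show False by simp
  qed
  \<comment> \<open>Mean values on the two halves of the interval lie at two different points, and the derivative
      is positive at one of them at least.\<close>
  define m where "m = (r + s) / 2"
  have m: "r < m" "m < s" using rs by (simp_all add: m_def)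
  obtain t where t: "r < t" "t < m" "G m - G r = (m - r) * G' t"
    using MVT2[OF m(1), of G G'] deriv rs by force
  obtain t' where t': "m < t'" "t' < s" "G s - G m = (s - m) * G' t'"
    using MVT2[OF m(2), of G G'] deriv rs m by force
  have "G' t > 0 \<or> G' t' > 0"
    using not_both[of t t'] G'_nonneg[of t] G'_nonneg[of t'] t t' rs by force
  then have "(m - r) * G' t + (s - m) * G' t' > 0"
    using m G'_nonneg[of t] G'_nonneg[of t'] t t' rs
    by (auto intro: add_pos_nonneg add_nonneg_pos)
  with t(3) t'(3) show ?thesis by (simp add: G_def)
qed

section \<open>Symmetrised divergence\<close>

text \<open>
  The symmetrised Kullback--Leibler divergence (Jeffreys divergence) of two positive weight functions.
\<close>
definition sym_divergence :: "'a set \<Rightarrow> ('a \<Rightarrow> real) \<Rightarrow> ('a \<Rightarrow> real) \<Rightarrow> real" where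
  "sym_divergence X p q = (\<Sum>x\<in>X. (p x - q x) * (ln (p x) - ln (q x)))"

lemma sym_divergence_nonneg:
  assumes "\<And>x. x \<in> X \<Longrightarrow> 0 < p x" "\<And>x. x \<in> X \<Longrightarrow> 0 < q x"
  shows "0 \<le> sym_divergence X p q"
  unfolding sym_divergence_def
proof (rule sum_nonneg)
  fix x assume x: "x \<in> X"
  show "0 \<le> (p x - q x) * (ln (p x) - ln (q x))"
    using assms[OF x] by (cases "p x \<le> q x") (auto simp: zero_le_mult_iff)
qed

lemma sum_PiE_prod_marginal:
  fixes p g :: "'a \<Rightarrow> real"
  assumes "finite I" "finite X" "(\<Sum>x\<in>X. p x) = 1" "c \<in> I"
  shows "(\<Sum>y\<in>PiE I (\<lambda>_. X). (\<Prod>i\<in>I. p (y i)) * g (y c)) = (\<Sum>x\<in>X. p x * g x)"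
proof -
  define f where "f = (\<lambda>i x. p x * (if i = c then g x else 1))"
  have "(\<Prod>i\<in>I. \<Sum>x\<in>X. f i x) = (\<Sum>y\<in>PiE I (\<lambda>_. X). \<Prod>i\<in>I. f i (y i))"
    by (rule prod_sum_PiE) (use assms in auto)
  moreover have "(\<Prod>i\<in>I. f i (y i)) = (\<Prod>i\<in>I. p (y i)) * g (y c)" for y
    unfolding f_def prod.distrib using assms by (simp add: prod.delta)
  moreover have "(\<Prod>i\<in>I. \<Sum>x\<in>X. f i x) = (\<Prod>i\<in>I. if i = c then \<Sum>x\<in>X. p x * g x else 1)"
    using assms(3) by (intro prod.cong) (auto simp: f_def)
  ultimately show ?thesis using assms by (simp add: prod.delta)
qed

text \<open>
  The logarithm of a product ratio is the sum of the logarithms, and each summand only involves one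
  factor of the product law, so that the other factors integrate to one.
\<close>
lemma sym_divergence_tensor:
  fixes p q :: "'a \<Rightarrow> real"
  assumes fin: "finite I" "finite X"
    and pos: "\<And>x. x \<in> X \<Longrightarrow> 0 < p x" "\<And>x. x \<in> X \<Longrightarrow> 0 < q x"
    and sums: "(\<Sum>x\<in>X. p x) = 1" "(\<Sum>x\<in>X. q x) = 1"
  shows "sym_divergence (PiE I (\<lambda>_. X)) (\<lambda>y. \<Prod>i\<in>I. p (y i)) (\<lambda>y. \<Prod>i\<in>I. q (y i))
    = real (card I) * sym_divergence X p q"
proof -
  define g where "g = (\<lambda>x. ln (p x) - ln (q x))"
  have ln_prod': "ln (\<Prod>i\<in>I. f (y i)) = (\<Sum>i\<in>I. ln (f (y i)))"
    if "y \<in> PiE I (\<lambda>_. X)" "\<And>x. x \<in> X \<Longrightarrow> 0 < f x" for y and f :: "'a \<Rightarrow> real"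
    by (rule ln_prod) (use that fin in \<open>fastforce simp: PiE_iff\<close>)+
  have "sym_divergence (PiE I (\<lambda>_. X)) (\<lambda>y. \<Prod>i\<in>I. p (y i)) (\<lambda>y. \<Prod>i\<in>I. q (y i))
      = (\<Sum>y\<in>PiE I (\<lambda>_. X). \<Sum>i\<in>I. (\<Prod>i\<in>I. p (y i)) * g (y i) - (\<Prod>i\<in>I. q (y i)) * g (y i))"
    unfolding sym_divergence_def
    by (intro sum.cong refl)
      (simp add: ln_prod' pos g_def sum_subtractf flip: sum_distrib_left left_diff_distrib)
  also have "\<dots> = (\<Sum>i\<in>I. (\<Sum>y\<in>PiE I (\<lambda>_. X). (\<Prod>i\<in>I. p (y i)) * g (y i))
                          - (\<Sum>y\<in>PiE I (\<lambda>_. X). (\<Prod>i\<in>I. q (y i)) * g (y i)))"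
    by (subst sum.swap) (simp add: sum_subtractf)
  also have "\<dots> = (\<Sum>i\<in>I. (\<Sum>x\<in>X. p x * g x) - (\<Sum>x\<in>X. q x * g x))"
    by (intro sum.cong refl) (simp add: sum_PiE_prod_marginal fin sums)
  also have "\<dots> = real (card I) * sym_divergence X p q"
    by (simp add: sym_divergence_def g_def algebra_simps sum_subtractf sum.distrib)
  finally show ?thesis .
qed

section \<open>The law of a level of the tree\<close>

definition level :: "nat \<Rightarrow> nat \<Rightarrow> nat list set" where
  "level k n = {w \<in> tree k. length w = n}"

definition level_configs :: "nat \<Rightarrow> nat \<Rightarrow> (nat list \<Rightarrow> 2) set" where
  "level_configs k n = (\<Pi>\<^sub>E w\<in>level k n. UNIV)"

text \<open>
  The configuration that \<open>x\<close> induces on the subtree of the child \<open>[c]\<close> of the root. The step to that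
  child is the last entry of a path because paths list the most recent step first.
\<close>
definition branch :: "nat \<Rightarrow> nat \<Rightarrow> (nat list \<Rightarrow> 2) \<Rightarrow> nat \<Rightarrow> nat list \<Rightarrow> 2" where
  "branch k n x c = (\<lambda>w\<in>level k n. x (w @ [c]))"

text \<open>
  The conditional law of the values on level \<open>n\<close>, given the value \<open>i\<close> of the root, in the top-down
  form: the \<open>k\<close> subtrees of the children are independent and each child draws its value from row \<open>i\<close>.
  The divergence of these laws for \<open>i = 0\<close> and \<open>i = 1\<close> is controlled through this product form.
\<close>
primrec level_law :: "nat \<Rightarrow> real^2^2 \<Rightarrow> nat \<Rightarrow> 2 \<Rightarrow> (nat list \<Rightarrow> 2) \<Rightarrow> real" where
  "level_law k P 0 i x = (if x [] = i then 1 else 0)"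
| "level_law k P (Suc n) i x = (\<Prod>c<k. \<Sum>j\<in>UNIV. P $ i $ j * level_law k P n j (branch k n x c))"

definition child_law :: "nat \<Rightarrow> real^2^2 \<Rightarrow> nat \<Rightarrow> 2 \<Rightarrow> (nat list \<Rightarrow> 2) \<Rightarrow> real" where
  "child_law k P n i y = (\<Sum>j\<in>UNIV. P $ i $ j * level_law k P n j y)"

lemma level_law_Suc: "level_law k P (Suc n) i x = (\<Prod>c<k. child_law k P n i (branch k n x c))"
  by (simp add: child_law_def)

declare level_law.simps(2) [simp del]

lemma sum_2: "(\<Sum>j\<in>UNIV. f j) = f 0 + f (1::2)" for f :: "2 \<Rightarrow> real"
  by (simp add: UNIV_2_eq)

lemma level_0: "level k 0 = {[]}"
  by (auto simp: level_def)

lemma level_Suc_snoc: "level k (Suc n) = (\<Union>c<k. (\<lambda>w. w @ [c]) ` level k n)"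
proof (intro subset_antisym subsetI)
  fix v assume v: "v \<in> level k (Suc n)"
  then show "v \<in> (\<Union>c<k. (\<lambda>w. w @ [c]) ` level k n)"
    by (cases v rule: rev_cases) (auto simp: level_def)
qed (auto simp: level_def)

lemma finite_level [simp]: "finite (level k n)"
  by (induction n) (simp_all add: level_0 level_Suc_snoc)

lemma finite_level_configs [simp]: "finite (level_configs k n)"
  by (simp add: level_configs_def finite_PiE)

lemma branch_in_level_configs: "branch k n x c \<in> level_configs k n"
  by (simp add: branch_def level_configs_def)

lemma bij_betw_branches:
  "bij_betw (\<lambda>x. \<lambda>c\<in>{..<k}. branch k n x c) (level_configs k (Suc n))
     (\<Pi>\<^sub>E c\<in>{..<k}. level_configs k n)"
proof (rule bij_betw_byWitness[where f' =
      "\<lambda>Y. \<lambda>v\<in>level k (Suc n). Y (last v) (butlast v)"])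
  show "\<forall>x\<in>level_configs k (Suc n).
      (\<lambda>v\<in>level k (Suc n). (\<lambda>c\<in>{..<k}. branch k n x c) (last v) (butlast v)) = x"
  proof
    fix x assume x: "x \<in> level_configs k (Suc n)"
    show "(\<lambda>v\<in>level k (Suc n). (\<lambda>c\<in>{..<k}. branch k n x c) (last v) (butlast v)) = x"
    proof
      fix v show "(\<lambda>v\<in>level k (Suc n). (\<lambda>c\<in>{..<k}. branch k n x c) (last v) (butlast v)) v = x v"
      proof (cases "v \<in> level k (Suc n)")
        case True
        then obtain c w where "v = w @ [c]" "c < k" "w \<in> level k n"
          by (auto simp: level_Suc_snoc)
        with True show ?thesis by (simp add: branch_def)
      next
        case False
        with x have "x v = undefined" unfolding level_configs_def by (rule PiE_arb)
        with False show ?thesis by simp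
      qed
    qed
  qed
  show "\<forall>Y\<in>(\<Pi>\<^sub>E c\<in>{..<k}. level_configs k n).
      (\<lambda>c\<in>{..<k}. branch k n (\<lambda>v\<in>level k (Suc n). Y (last v) (butlast v)) c) = Y"
  proof
    fix Y assume Y: "Y \<in> (\<Pi>\<^sub>E c\<in>{..<k}. level_configs k n)"
    show "(\<lambda>c\<in>{..<k}. branch k n (\<lambda>v\<in>level k (Suc n). Y (last v) (butlast v)) c) = Y"
    proof (intro ext)
      fix c w
      show "(\<lambda>c\<in>{..<k}. branch k n (\<lambda>v\<in>level k (Suc n). Y (last v) (butlast v)) c) c w = Y c w"
      proof (cases "c < k")
        case True
        with Y have Yc: "Y c \<in> level_configs k n" by auto
        show ?thesis
        proof (cases "w \<in> level k n")
          case w: True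
          with True have "w @ [c] \<in> level k (Suc n)" by (auto simp: level_Suc_snoc)
          with True w show ?thesis by (simp add: branch_def)
        next
          case False
          with Yc have "Y c w = undefined" unfolding level_configs_def by (rule PiE_arb)
          with True False show ?thesis by (simp add: branch_def)
        qed
      next
        case False
        with Y have "Y c = undefined" by (intro PiE_arb) auto
        with False show ?thesis by simp
      qed
    qed
  qed
  show "(\<lambda>x. \<lambda>c\<in>{..<k}. branch k n x c) ` level_configs k (Suc n)
      \<subseteq> (\<Pi>\<^sub>E c\<in>{..<k}. level_configs k n)"
    by (rule image_subsetI) (simp add: branch_in_level_configs)
  show "(\<lambda>Y. \<lambda>v\<in>level k (Suc n). Y (last v) (butlast v)) ` (\<Pi>\<^sub>E c\<in>{..<k}. level_configs k n)
      \<subseteq> level_configs k (Suc n)"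
    by (rule image_subsetI) (simp add: level_configs_def)
qed

lemma sum_over_branches:
  "(\<Sum>x\<in>level_configs k (Suc n). F (\<lambda>c\<in>{..<k}. branch k n x c))
     = (\<Sum>Y\<in>(\<Pi>\<^sub>E c\<in>{..<k}. level_configs k n). F Y)"
  by (rule sum.reindex_bij_betw[OF bij_betw_branches])

lemma sum_prod_branches:
  "(\<Sum>x\<in>level_configs k (Suc n). \<Prod>c<k. f c (branch k n x c))
     = (\<Sum>Y\<in>(\<Pi>\<^sub>E c\<in>{..<k}. level_configs k n). \<Prod>c<k. f c (Y c))"
  using sum_over_branches[where F = "\<lambda>Y. \<Prod>c<k. f c (Y c)" and k = k and n = n] by simp

locale broadcast =
  fixes k :: nat and P :: "real^2^2"
  assumes P: "stochastic P"
begin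

lemma P_nonneg [simp]: "0 \<le> P $ i $ j"
  using P by (simp add: stochastic_def)

lemma P_row: "P $ i $ 0 + P $ i $ 1 = 1"
  using P by (simp add: stochastic_def sum_2)

lemma level_law_nonneg: "0 \<le> level_law k P n i x"
  by (induction n arbitrary: i x) (auto simp: level_law.simps(2) intro!: prod_nonneg sum_nonneg)

lemma sum_level_law: "(\<Sum>x\<in>level_configs k n. level_law k P n i x) = 1"
proof (induction n arbitrary: i)
  case 0
  have "level_configs k 0 = (\<lambda>j. \<lambda>w\<in>{[]}. j) ` (UNIV :: 2 set)"
    by (auto simp: level_configs_def level_0 PiE_def extensional_def image_iff fun_eq_iff)
  moreover have "inj (\<lambda>j :: 2. \<lambda>w\<in>{[] :: nat list}. j)"
    by (rule injI) (auto dest: fun_cong[of _ _ "[]"])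
  ultimately show ?case
    by (simp add: sum.reindex)
next
  case (Suc n)
  have "(\<Sum>x\<in>level_configs k n. child_law k P n i x) = 1"
    unfolding child_law_def using Suc P_row[of i]
    by (simp add: sum_2 sum.distrib flip: sum_distrib_left)
  then show ?case
    using prod_sum_PiE[of "{..<k}" "\<lambda>_. level_configs k n" "\<lambda>_. child_law k P n i"]
    by (simp add: level_law_Suc sum_prod_branches[where f = "\<lambda>_. child_law k P n i"])
qed

lemma sum_child_law: "(\<Sum>x\<in>level_configs k n. child_law k P n i x) = 1"
  using P_row[of i] sum_level_law[of n]
  by (simp add: child_law_def sum_2 sum.distrib flip: sum_distrib_left)

text \<open>
  The bottom-up form of the same law: level \<open>n + 1\<close> arises from level \<open>n\<close> by one transition along each
  edge. This is the form in which the law is found from the cylinder probabilities of the walk. The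
  two forms agree because the edges between the levels \<open>n\<close> and \<open>n + 1\<close> split into those
  of the \<open>k\<close> subtrees, and a product over the subtrees of sums is a sum over configurations of products.
\<close>
lemma level_law_step:
  "level_law k P (Suc n) i x =
     (\<Sum>y\<in>level_configs k n. level_law k P n i y * (\<Prod>w\<in>level k (Suc n). P $ y (tl w) $ x w))"
proof (induction n arbitrary: i x)
  case 0
  have "(\<Sum>y\<in>level_configs k 0. level_law k P 0 i y * (\<Prod>w\<in>level k 1. P $ y (tl w) $ x w))
     = (\<Sum>y\<in>level_configs k 0. level_law k P 0 i y * (\<Prod>c<k. P $ i $ x [c]))"
  proof (intro sum.cong refl)
    fix y
    have "(\<Prod>w\<in>level k 1. P $ y (tl w) $ x w) = (\<Prod>c<k. P $ y [] $ x [c])"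
      unfolding One_nat_def level_Suc_snoc level_0
      by (subst prod.UNION_disjoint) auto
    then show "level_law k P 0 i y * (\<Prod>w\<in>level k 1. P $ y (tl w) $ x w) =
        level_law k P 0 i y * (\<Prod>c<k. P $ i $ x [c])"
      by simp
  qed
  also have "\<dots> = (\<Prod>c<k. P $ i $ x [c])"
    using sum_level_law[of 0 i] by (simp flip: sum_distrib_right)
  also have "\<dots> = level_law k P 1 i x"
    unfolding One_nat_def level_law.simps
    by (simp add: branch_def level_0 if_distrib[of "times _"] cong: if_cong)
  finally show ?case by simp
next
  case (Suc n)
  define K where "K = (\<lambda>n y x. \<Prod>w\<in>level k (Suc n). P $ y (tl w) $ x w)"
  have K_branches: "K (Suc n) y x = (\<Prod>c<k. K n (branch k n y c) (branch k (Suc n) x c))" for y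
  proof -
    have "K (Suc n) y x = (\<Prod>c<k. \<Prod>w\<in>level k (Suc n). P $ y (tl (w @ [c])) $ x (w @ [c]))"
      unfolding K_def level_Suc_snoc[of k "Suc n"]
      by (subst prod.UNION_disjoint) (auto simp: prod.reindex inj_on_def)
    also have "\<dots> = (\<Prod>c<k. K n (branch k n y c) (branch k (Suc n) x c))"
      unfolding K_def
    proof (intro prod.cong refl)
      fix c w assume w: "w \<in> level k (Suc n)"
      then have "w \<noteq> []" "tl w \<in> level k n"
        by (cases w; auto simp: level_def)+
      with w show "P $ y (tl (w @ [c])) $ x (w @ [c])
          = P $ branch k n y c (tl w) $ branch k (Suc n) x c w"
        by (simp add: branch_def)
    qed
    finally show ?thesis .
  qed
  have child: "child_law k P (Suc n) i z = (\<Sum>y\<in>level_configs k n. child_law k P n i y * K n y z)" for z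
    unfolding child_law_def Suc K_def
    by (simp add: sum_2 distrib_right sum.distrib sum_distrib_left mult.assoc)
  have "level_law k P (Suc (Suc n)) i x =
      (\<Prod>c<k. \<Sum>y\<in>level_configs k n. child_law k P n i y * K n y (branch k (Suc n) x c))"
    unfolding level_law_Suc child ..
  also have "\<dots> = (\<Sum>Y\<in>(\<Pi>\<^sub>E c\<in>{..<k}. level_configs k n).
      \<Prod>c<k. child_law k P n i (Y c) * K n (Y c) (branch k (Suc n) x c))"
    by (rule prod_sum_PiE) auto
  also have "\<dots> = (\<Sum>y\<in>level_configs k (Suc n). level_law k P (Suc n) i y * K (Suc n) y x)"
    unfolding K_branches level_law_Suc
    by (subst sum_prod_branches[symmetric]) (simp add: prod.distrib)
  finally show ?case unfolding K_def .
qed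

end

section \<open>The level laws merge\<close>

text \<open>
  The irreducible and aperiodic case. A single entry of \<open>P\<close> may vanish, and then the two laws on
  level 1 have different supports and no finite divergence. From level 2 on all weights are positive,
  so the argument starts there.
\<close>
locale subcritical_broadcast = broadcast +
  assumes off_diagonal: "0 < P $ 0 $ 1" "0 < P $ 1 $ 0"
    and aperiodic: "0 < P $ 0 $ 0 \<or> 0 < P $ 1 $ 1"
    and threshold:
      "real k * (sqrt (P $ 0 $ 0 * P $ 1 $ 1) - sqrt (P $ 0 $ 1 * P $ 1 $ 0))\<^sup>2 \<le> 1"
begin

lemma level_law_pos:
  assumes "2 \<le> n"
  shows "0 < level_law k P n i x"
proof -
  \<comment> \<open>The state \<open>s\<close> is one with a positive diagonal entry; its row and its column are positive.\<close>
  have "\<exists>s. \<forall>j. 0 < P $ s $ j \<and> 0 < P $ j $ s"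
    using off_diagonal aperiodic unfolding forall_2_iff by blast
  then obtain s where row: "0 < P $ s $ j" and col: "0 < P $ j $ s" for j
    by blast
  have next_level: "0 < level_law k P (Suc m) i x" if "\<And>y. 0 < level_law k P m s y" for m i x
  proof -
    have "0 < child_law k P m i y" for y
      unfolding child_law_def
      by (rule sum_pos2[of _ s]) (use that col level_law_nonneg in auto)
    then show ?thesis unfolding level_law_Suc by (intro prod_pos) auto
  qed
  have one: "0 < level_law k P 1 s y" for y
  proof -
    have "child_law k P 0 s z = P $ s $ z []" for z
      by (simp add: child_law_def if_distrib[of "times _"] cong: if_cong)
    then show ?thesis
      unfolding One_nat_def level_law_Suc using row by (intro prod_pos) simp
  qed
  from assms show ?thesis
  proof (induction n arbitrary: i x rule: dec_induct)
    case base
    show ?case unfolding numeral_2_eq_2 by (rule next_level) (use one in simp)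
  next
    case (step m)
    then show ?case by (intro next_level)
  qed
qed

lemma child_law_pos:
  assumes "2 \<le> n"
  shows "0 < child_law k P n i y"
proof -
  have "0 < P $ i $ 0 \<or> 0 < P $ i $ 1"
    using P_row[of i] P_nonneg[of i 0] P_nonneg[of i 1] by linarith
  then obtain j where "0 < P $ i $ j" by blast
  then show ?thesis
    unfolding child_law_def using level_law_pos[OF assms]
    by (intro sum_pos2[of _ j]) (auto simp: level_law_nonneg)
qed

definition level_divergence :: "nat \<Rightarrow> real" where
  "level_divergence n = sym_divergence (level_configs k n) (level_law k P n 0) (level_law k P n 1)"

lemma level_divergence_nonneg: "2 \<le> n \<Longrightarrow> 0 \<le> level_divergence n"
  unfolding level_divergence_def by (intro sym_divergence_nonneg level_law_pos)

lemma level_divergence_Suc: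
  assumes "2 \<le> n"
  shows "level_divergence (Suc n)
    = real k * sym_divergence (level_configs k n) (child_law k P n 0) (child_law k P n 1)"
proof -
  have "level_divergence (Suc n) = sym_divergence (\<Pi>\<^sub>E c\<in>{..<k}. level_configs k n)
      (\<lambda>Y. \<Prod>c<k. child_law k P n 0 (Y c)) (\<lambda>Y. \<Prod>c<k. child_law k P n 1 (Y c))"
    unfolding level_divergence_def sym_divergence_def
    by (subst sum_over_branches[symmetric]) (simp add: level_law_Suc)
  also have "\<dots> = real (card {..<k})
      * sym_divergence (level_configs k n) (child_law k P n 0) (child_law k P n 1)"
    by (rule sym_divergence_tensor) (use assms in \<open>auto simp: child_law_pos sum_child_law\<close>)
  finally show ?thesis by simp
qed

text \<open>
  In terms of the likelihood ratio \<open>r\<close>, the divergence on one level is the mean of \<open>(r - 1) ln r\<close>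
  under the law given \<open>1\<close>, and the divergence on the next level is the mean of \<open>r - 1\<close> times the term
  subtracted here from \<open>ln r\<close>.
\<close>
definition gain :: "real \<Rightarrow> real" where
  "gain r = ln r - real k * (P $ 0 $ 0 - P $ 1 $ 0)
     * (ln (P $ 0 $ 0 * r + P $ 0 $ 1) - ln (P $ 1 $ 0 * r + P $ 1 $ 1))"

lemma gain_1: "gain 1 = 0"
  by (simp add: gain_def P_row)

lemma gain_strict_mono: "0 < r \<Longrightarrow> r < s \<Longrightarrow> gain r < gain s"
  unfolding gain_def
  by (rule log_likelihood_gain_strict_mono)
    (use off_diagonal aperiodic threshold P_row in auto)

lemma gain_sign: "0 < r \<Longrightarrow> 0 \<le> (r - 1) * gain r"
  using gain_strict_mono[of r 1] gain_strict_mono[of 1 r] gain_1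
  by (cases r "1 :: real" rule: linorder_cases) (auto simp: zero_le_mult_iff)

abbreviation likelihood_ratio :: "nat \<Rightarrow> (nat list \<Rightarrow> 2) \<Rightarrow> real" where
  "likelihood_ratio n x \<equiv> level_law k P n 0 x / level_law k P n 1 x"

definition divergence_loss :: "nat \<Rightarrow> real" where
  "divergence_loss n = (\<Sum>x\<in>level_configs k n.
     level_law k P n 1 x * ((likelihood_ratio n x - 1) * gain (likelihood_ratio n x)))"

text \<open>
  Mixing with the rows of \<open>P\<close> multiplies the difference of the two laws by \<open>p\<^sub>0\<^sub>0 - p\<^sub>1\<^sub>0\<close> and
  transforms their ratio by the linear fractional map of \<open>P\<close>; the \<open>k\<close> independent subtrees contribute
  the factor \<open>k\<close>.
\<close>
lemma level_divergence_drop: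
  assumes n: "2 \<le> n"
  shows "level_divergence n - level_divergence (Suc n) = divergence_loss n"
proof -
  have "level_law k P n 1 x * ((likelihood_ratio n x - 1) * gain (likelihood_ratio n x))
    = (level_law k P n 0 x - level_law k P n 1 x) * (ln (level_law k P n 0 x) - ln (level_law k P n 1 x))
    - real k * ((child_law k P n 0 x - child_law k P n 1 x)
               * (ln (child_law k P n 0 x) - ln (child_law k P n 1 x)))" for x
  proof -
    define p q where "p = level_law k P n 0 x" and "q = level_law k P n 1 x"
    have pos: "0 < p" "0 < q" using level_law_pos[OF n] by (simp_all add: p_def q_def)
    have child: "child_law k P n i x = P $ i $ 0 * p + P $ i $ 1 * q" for i
      by (simp add: child_law_def sum_2 p_def q_def)
    have ln_child: "ln (P $ i $ 0 * (p / q) + P $ i $ 1) = ln (child_law k P n i x) - ln q" for i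
    proof -
      have "P $ i $ 0 * (p / q) + P $ i $ 1 = child_law k P n i x / q"
        using pos by (simp add: child field_simps)
      then show ?thesis using child_law_pos[OF n, of i x] pos by (simp add: ln_div)
    qed
    have diff: "child_law k P n 0 x - child_law k P n 1 x = (P $ 0 $ 0 - P $ 1 $ 0) * (p - q)"
      using P_row[of 0] P_row[of 1] unfolding child by algebra
    have "q * ((p / q - 1) * gain (p / q)) = (p - q) * gain (p / q)"
      using pos by (simp add: field_simps)
    also have "\<dots> = (p - q) * (ln p - ln q) - real k * ((P $ 0 $ 0 - P $ 1 $ 0) * (p - q)
        * (ln (child_law k P n 0 x) - ln (child_law k P n 1 x)))"
      unfolding gain_def ln_child using pos by (simp add: ln_div algebra_simps)
    finally show ?thesis unfolding diff p_def q_def .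
  qed
  then show ?thesis
    unfolding level_divergence_Suc[OF n] divergence_loss_def
    by (simp add: level_divergence_def sym_divergence_def sum_subtractf sum_distrib_left)
qed

text \<open>
  The losses are the decrements of a nonnegative sequence, so they cannot all exceed
  a positive bound. This covers the critical case, in which no contraction factor below one is available.
\<close>
lemma exists_small_divergence_loss:
  assumes "0 < \<epsilon>"
  obtains n where "2 \<le> n" "divergence_loss n < \<epsilon>"
proof -
  have "\<exists>n\<ge>2. divergence_loss n < \<epsilon>"
  proof (rule ccontr)
    assume "\<not> ?thesis"
    then have large: "\<epsilon> \<le> divergence_loss n" if "2 \<le> n" for n using that by force
    have "level_divergence (2 + m) \<le> level_divergence 2 - real m * \<epsilon>" for m
    proof (induction m)
      case (Suc m)
      show ?case
        using Suc large[of "2 + m"] level_divergence_drop[of "2 + m"] by (simp add: algebra_simps)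
    qed simp
    moreover obtain m where "level_divergence 2 < real m * \<epsilon>"
      using reals_Archimedean3[OF assms] by blast
    ultimately show False
      using level_divergence_nonneg[of "2 + m"] by (smt (verit) le_add1)
  qed
  with that show thesis by blast
qed

text \<open>
  Since \<open>gain\<close> is strictly increasing with zero at \<open>1\<close>, the integrand \<open>(r - 1) gain r\<close> of the loss is
  bounded below where \<open>r \<le> 1 - \<delta>\<close>, so a small loss makes this set improbable under the law given \<open>1\<close>.
  The ratios above \<open>1\<close> are then controlled as well: both laws have mass one, so their \<open>L\<^sup>1\<close>
  distance is twice the mean of the negative part of \<open>r - 1\<close>.
\<close>
proposition level_laws_merge:
  assumes "0 < \<epsilon>"
  obtains n where "2 \<le> n"
    "(\<Sum>x\<in>level_configs k n. \<bar>level_law k P n 0 x - level_law k P n 1 x\<bar>) \<le> \<epsilon>"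
proof -
  define \<delta> where "\<delta> = min (\<epsilon> / 4) (1 / 2)"
  have \<delta>: "0 < \<delta>" "\<delta> < 1" "4 * \<delta> \<le> \<epsilon>" using assms by (auto simp: \<delta>_def)
  define \<gamma> where "\<gamma> = - gain (1 - \<delta>)"
  have \<gamma>: "0 < \<gamma>" using gain_strict_mono[of "1 - \<delta>" 1] gain_1 \<delta> by (simp add: \<gamma>_def)
  obtain n where n: "2 \<le> n" and loss: "divergence_loss n < \<delta> * (\<delta> * \<gamma>)"
    using exists_small_divergence_loss[of "\<delta> * (\<delta> * \<gamma>)"] \<delta> \<gamma> by auto
  let ?p = "level_law k P n 0" and ?q = "level_law k P n 1"
  let ?loss = "\<lambda>x. ?q x * ((likelihood_ratio n x - 1) * gain (likelihood_ratio n x))"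
  have pointwise: "\<bar>?p x - ?q x\<bar> \<le> (?p x - ?q x) + 2 * (\<delta> * ?q x + ?loss x / (\<delta> * \<gamma>))" for x
  proof -
    define r where "r = likelihood_ratio n x"
    have q: "0 < ?q x" and r: "0 < r" and p: "?p x = r * ?q x"
      using level_law_pos[OF n, of 0 x] level_law_pos[OF n, of 1 x] by (simp_all add: r_def)
    have "1 - r \<le> \<delta> + (r - 1) * gain r / (\<delta> * \<gamma>)"
    proof (cases "1 - \<delta> \<le> r")
      case True
      moreover have "0 \<le> (r - 1) * gain r / (\<delta> * \<gamma>)"
        using gain_sign[OF r] \<delta> \<gamma> by (intro divide_nonneg_pos mult_pos_pos)
      ultimately show ?thesis by linarith
    next
      case False
      then have "\<gamma> \<le> - gain r" using gain_strict_mono[of r "1 - \<delta>"] r by (simp add: \<gamma>_def)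
      with False have "\<delta> * \<gamma> \<le> (1 - r) * (- gain r)"
        using \<delta> \<gamma> by (intro mult_mono) auto
      then have "1 \<le> (r - 1) * gain r / (\<delta> * \<gamma>)"
        using \<delta> \<gamma> by (simp add: algebra_simps)
      with r \<delta> show ?thesis by linarith
    qed
    moreover have "0 \<le> \<delta> + (r - 1) * gain r / (\<delta> * \<gamma>)"
      using gain_sign[OF r] \<delta> \<gamma> by (intro add_nonneg_nonneg divide_nonneg_pos mult_pos_pos) auto
    moreover have "\<bar>r - 1\<bar> \<le> (r - 1) + 2 * e" if "1 - r \<le> e" "0 \<le> e" for e
      using that by linarith
    ultimately have "\<bar>r - 1\<bar> \<le> (r - 1) + 2 * (\<delta> + (r - 1) * gain r / (\<delta> * \<gamma>))"
      by blast
    then have "\<bar>r - 1\<bar> * ?q x \<le> ((r - 1) + 2 * (\<delta> + (r - 1) * gain r / (\<delta> * \<gamma>))) * ?q x"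
      using q by (intro mult_right_mono) auto
    moreover have "\<bar>?p x - ?q x\<bar> = \<bar>r - 1\<bar> * ?q x"
      using q by (simp add: p abs_mult flip: left_diff_distrib[of r 1, simplified])
    ultimately show ?thesis
      unfolding r_def[symmetric] p by (simp add: algebra_simps)
  qed
  have "(\<Sum>x\<in>level_configs k n. \<bar>?p x - ?q x\<bar>)
      \<le> (\<Sum>x\<in>level_configs k n. (?p x - ?q x) + 2 * (\<delta> * ?q x + ?loss x / (\<delta> * \<gamma>)))"
    by (rule sum_mono) (rule pointwise)
  also have "\<dots> = 2 * (\<delta> + divergence_loss n / (\<delta> * \<gamma>))"
    unfolding divergence_loss_def sum.distrib sum_subtractf sum_distrib_left[symmetric]
      sum_divide_distrib[symmetric] by (simp add: sum_level_law)
  also have "\<dots> \<le> 2 * (\<delta> + \<delta>)"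
    using loss \<delta> \<gamma> by (simp add: pos_divide_le_eq)
  also have "\<dots> \<le> \<epsilon>" using \<delta> by simp
  finally show thesis using n that by blast
qed

end

section \<open>Cylinder probabilities and the Markov property\<close>

definition cylinder :: "nat \<Rightarrow> nat list set \<Rightarrow> (nat list \<Rightarrow> 2) \<Rightarrow> (nat list \<Rightarrow> 2) set" where
  "cylinder k S x = {\<phi> \<in> space (configs k). \<forall>v\<in>S. \<phi> v = x v}"

lemma cylinder_cong: "(\<And>v. v \<in> S \<Longrightarrow> x v = y v) \<Longrightarrow> cylinder k S x = cylinder k S y"
  by (auto simp: cylinder_def)

lemma cylinder_Un: "cylinder k (S \<union> T) x = cylinder k S x \<inter> cylinder k T x"
  by (auto simp: cylinder_def)

lemma sets_cylinder:
  assumes "finite S" "S \<subseteq> tree k"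
  shows "cylinder k S x \<in> sets (configs k)"
proof -
  have "{\<phi> \<in> space (configs k). \<phi> v = x v} \<in> sets (configs k)" if "v \<in> S" for v
  proof -
    have "(\<lambda>\<phi>. \<phi> v) \<in> measurable (configs k) (count_space UNIV)"
      using that assms unfolding configs_def by (intro measurable_component_singleton) auto
    then have "(\<lambda>\<phi>. \<phi> v) -` {x v} \<inter> space (configs k) \<in> sets (configs k)"
      by (rule measurable_sets) simp
    also have "(\<lambda>\<phi>. \<phi> v) -` {x v} \<inter> space (configs k) = {\<phi> \<in> space (configs k). \<phi> v = x v}"
      by blast
    finally show ?thesis .
  qed
  then show ?thesis
    unfolding cylinder_def using assms(1) by (intro sets.sets_Collect_finite_All)
qed

lemma descendants_eq: "descendants k d u = (\<lambda>w. w @ u) ` level k d"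
  by (auto simp: descendants_def level_def)

lemma finite_descendants [simp]: "finite (descendants k d u)"
  by (simp add: descendants_eq)

lemma descendants_0: "descendants k 0 u = {u}"
  by (simp add: descendants_eq level_0)

lemma length_descendants: "v \<in> descendants k d u \<Longrightarrow> length v = d + length u"
  by (auto simp: descendants_def)

lemma tl_descendants: "v \<in> descendants k (Suc d) u \<Longrightarrow> tl v \<in> descendants k d u"
  by (auto simp: descendants_def length_Suc_conv)

definition relative_path :: "nat list \<Rightarrow> nat list \<Rightarrow> nat list" where
  "relative_path u v = take (length v - length u) v"

lemma relative_path_append [simp]: "relative_path u (w @ u) = w"
  by (simp add: relative_path_def)

lemma level_law_cong:
  assumes "\<And>w. w \<in> level k n \<Longrightarrow> x w = y w"
  shows "level_law k P n i x = level_law k P n i y"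
proof (cases n)
  case 0
  with assms show ?thesis by (simp add: level_0)
next
  case (Suc m)
  have "branch k m x c = branch k m y c" if "c < k" for c
    unfolding branch_def using assms that by (intro restrict_ext) (auto simp: Suc level_Suc_snoc)
  then show ?thesis by (simp add: Suc level_law_Suc)
qed

locale stationary_broadcast = broadcast +
  assumes switch: "0 < P $ 0 $ 1 + P $ 1 $ 0"
begin

sublocale brw: prob_space "brw k P"
  by (rule prob_space_brw)

abbreviation prob :: "(nat list \<Rightarrow> 2) set \<Rightarrow> real" where
  "prob \<equiv> measure (brw k P)"

lemma prob_cylinder_closed:
  assumes "finite S" "S \<subseteq> tree k" "[] \<in> S" "\<And>c u. c # u \<in> S \<Longrightarrow> u \<in> S"
  shows "prob (cylinder k S x) = stationary P (x []) * (\<Prod>v\<in>S - {[]}. P $ x (tl v) $ x v)"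
  using brw_cylinder[OF P switch assms] by (simp add: cylinder_def)

text \<open>
  The law of total probability over the values at the finitely many nodes \<open>g w\<close>. The index set \<open>L\<close> may
  differ from the set of nodes, so that one can sum over configurations of an abstract level while
  the nodes lie below some \<open>u\<close>; the map \<open>h\<close> recovers the index from the node.
\<close>
lemma prob_partition:
  assumes A: "A \<in> sets (configs k)" and L: "finite L" "g ` L \<subseteq> tree k"
    and h: "\<And>w. w \<in> L \<Longrightarrow> h (g w) = w"
  shows "prob A = (\<Sum>z\<in>(\<Pi>\<^sub>E w\<in>L. UNIV). prob (A \<inter> cylinder k (g ` L) (\<lambda>v. z (h v))))"
proof -
  let ?C = "\<lambda>z. A \<inter> cylinder k (g ` L) (\<lambda>v. z (h v))"
  have "A = (\<Union>z\<in>(\<Pi>\<^sub>E w\<in>L. UNIV). ?C z)"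
  proof
    show "A \<subseteq> (\<Union>z\<in>(\<Pi>\<^sub>E w\<in>L. UNIV). ?C z)"
    proof
      fix \<phi> assume \<phi>: "\<phi> \<in> A"
      moreover from \<phi> have "\<phi> \<in> space (configs k)"
        using sets.sets_into_space[OF A] by blast
      ultimately have "\<phi> \<in> ?C (\<lambda>w\<in>L. \<phi> (g w))"
        using h by (simp add: cylinder_def)
      moreover have "(\<lambda>w\<in>L. \<phi> (g w)) \<in> (\<Pi>\<^sub>E w\<in>L. UNIV)" by simp
      ultimately show "\<phi> \<in> (\<Union>z\<in>(\<Pi>\<^sub>E w\<in>L. UNIV). ?C z)" by (rule UN_I[rotated])
    qed
  qed auto
  then have "prob A = prob (\<Union>z\<in>(\<Pi>\<^sub>E w\<in>L. UNIV). ?C z)" by simp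
  also have "\<dots> = (\<Sum>z\<in>(\<Pi>\<^sub>E w\<in>L. UNIV). prob (?C z))"
  proof (rule brw.finite_measure_finite_Union)
    show "finite (\<Pi>\<^sub>E w\<in>L. UNIV :: 2 set)" using L by (simp add: finite_PiE)
    show "?C ` (\<Pi>\<^sub>E w\<in>L. UNIV) \<subseteq> sets (brw k P)"
      using A L by (auto intro!: sets.Int sets_cylinder)
    show "disjoint_family_on ?C (\<Pi>\<^sub>E w\<in>L. UNIV)"
      unfolding disjoint_family_on_def
    proof (intro ballI impI)
      fix y z :: "'a \<Rightarrow> 2"
      assume yz: "y \<in> (\<Pi>\<^sub>E w\<in>L. UNIV)" "z \<in> (\<Pi>\<^sub>E w\<in>L. UNIV)" "y \<noteq> z"
      have "\<exists>w\<in>L. y w \<noteq> z w"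
        using PiE_ext[OF yz(1,2)] yz(3) by blast
      then obtain w where w: "w \<in> L" "y w \<noteq> z w" by blast
      have value_eq: "\<phi> (g w) = y w" if "\<phi> \<in> ?C y" for \<phi> y
        using that w(1) h[OF w(1)] unfolding cylinder_def by fastforce
      show "?C y \<inter> ?C z = {}"
      proof (rule ccontr)
        assume "?C y \<inter> ?C z \<noteq> {}"
        then obtain \<phi> where "\<phi> \<in> ?C y" "\<phi> \<in> ?C z" by (meson disjoint_iff)
        with value_eq[of \<phi> y] value_eq[of \<phi> z] w(2) show False by simp
      qed
    qed
  qed
  finally show ?thesis .
qed

text \<open>
  The Markov property of the walk for finite sets of nodes. When the values on all of \<open>S\<close> are prescribed,
  the product formula for cylinders over sets closed under parents gives the factor for \<open>N\<close>. This
  factor involves only \<open>F \<union> N\<close>, so it survives the summation over the values on \<open>S - F\<close>.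
\<close>
lemma prob_markov:
  assumes S: "finite S" "S \<subseteq> tree k" "[] \<in> S" "\<And>c u. c # u \<in> S \<Longrightarrow> u \<in> S"
    and N: "finite N" "N \<subseteq> tree k" "S \<inter> N = {}"
    and F: "F \<subseteq> S" and parents: "\<And>v. v \<in> N \<Longrightarrow> tl v \<in> F \<union> N"
  shows "prob (cylinder k (F \<union> N) x) = prob (cylinder k F x) * (\<Prod>v\<in>N. P $ x (tl v) $ x v)"
proof -
  have Nil: "[] \<notin> N" using S(3) N(3) by auto
  have F_fin: "finite F" "F \<subseteq> tree k" using F S finite_subset by auto
  let ?Z = "\<Pi>\<^sub>E v\<in>S - F. UNIV :: 2 set"
  define y where "y = (\<lambda>z v. if v \<in> F \<union> N then x v else z v)"
  have partition: "prob A = (\<Sum>z\<in>?Z. prob (A \<inter> cylinder k (S - F) z))"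
    if "A \<in> sets (configs k)" for A
  proof -
    have "finite (S - F)" "(\<lambda>v. v) ` (S - F) \<subseteq> tree k" using S(1,2) by auto
    from prob_partition[OF that this, of "\<lambda>v. v"] show ?thesis by simp
  qed
  have "prob (cylinder k (F \<union> N) x) = (\<Sum>z\<in>?Z. prob (cylinder k (F \<union> N) x \<inter> cylinder k (S - F) z))"
    using N(1,2) F_fin by (intro partition sets_cylinder) auto
  also have "\<dots> = (\<Sum>z\<in>?Z. prob (cylinder k (S \<union> N) (y z)))"
    using F N(3) by (intro sum.cong refl arg_cong[of _ _ prob]) (auto simp: cylinder_def y_def)
  also have "\<dots> = (\<Sum>z\<in>?Z. prob (cylinder k S (y z)) * (\<Prod>v\<in>N. P $ x (tl v) $ x v))"
  proof (intro sum.cong refl)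
    fix z
    have "prob (cylinder k (S \<union> N) (y z))
      = stationary P (y z []) * (\<Prod>v\<in>(S \<union> N) - {[]}. P $ y z (tl v) $ y z v)"
    proof (rule prob_cylinder_closed)
      show "u \<in> S \<union> N" if "c # u \<in> S \<union> N" for c u
        using that S(4)[of c u] parents[of "c # u"] F by auto
    qed (use S(1-3) N in auto)
    also have "(S \<union> N) - {[]} = (S - {[]}) \<union> N" using Nil by auto
    also have "(\<Prod>v\<in>(S - {[]}) \<union> N. P $ y z (tl v) $ y z v)
      = (\<Prod>v\<in>S - {[]}. P $ y z (tl v) $ y z v) * (\<Prod>v\<in>N. P $ y z (tl v) $ y z v)"
      using S(1) N by (intro prod.union_disjoint) auto
    also have "(\<Prod>v\<in>N. P $ y z (tl v) $ y z v) = (\<Prod>v\<in>N. P $ x (tl v) $ x v)"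
      using parents by (intro prod.cong refl) (auto simp: y_def)
    finally show "prob (cylinder k (S \<union> N) (y z))
        = prob (cylinder k S (y z)) * (\<Prod>v\<in>N. P $ x (tl v) $ x v)"
      using prob_cylinder_closed[OF S, where x = "y z"] by simp
  qed
  also have "\<dots> = (\<Sum>z\<in>?Z. prob (cylinder k F x \<inter> cylinder k (S - F) z))
      * (\<Prod>v\<in>N. P $ x (tl v) $ x v)"
    unfolding sum_distrib_right using F N(3)
    by (intro sum.cong refl arg_cong[of _ _ "\<lambda>A. prob A * _"]) (auto simp: cylinder_def y_def)
  also have "(\<Sum>z\<in>?Z. prob (cylinder k F x \<inter> cylinder k (S - F) z)) = prob (cylinder k F x)"
    using F_fin by (intro partition[symmetric] sets_cylinder)
  finally show ?thesis .
qed

definition ancestors :: "nat list \<Rightarrow> nat list set" where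
  "ancestors u = {v. \<exists>w. u = w @ v}"

lemma ancestors:
  shows finite_ancestors: "finite (ancestors u)"
    and ancestors_subset: "u \<in> tree k \<Longrightarrow> ancestors u \<subseteq> tree k"
    and Nil_in_ancestors: "[] \<in> ancestors u"
    and self_in_ancestors: "u \<in> ancestors u"
    and ancestors_closed: "c # v \<in> ancestors u \<Longrightarrow> v \<in> ancestors u"
    and length_ancestors: "v \<in> ancestors u \<Longrightarrow> length v \<le> length u"
proof -
  have "v \<in> (\<lambda>n. drop n u) ` {..length u}" if "v \<in> ancestors u" for v
  proof -
    from that obtain w where "u = w @ v" by (auto simp: ancestors_def)
    then have "v = drop (length w) u" "length w \<le> length u" by auto
    then show ?thesis by blast
  qed
  then have "ancestors u \<subseteq> (\<lambda>n. drop n u) ` {..length u}" by blast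
  then show "finite (ancestors u)" by (rule finite_subset) simp
  show "v \<in> ancestors u" if "c # v \<in> ancestors u"
  proof -
    from that obtain w where "u = (w @ [c]) @ v" by (auto simp: ancestors_def)
    then show ?thesis unfolding ancestors_def by blast
  qed
qed (auto simp: ancestors_def)

lemma stationary_fixed: "(\<Sum>j\<in>UNIV. stationary P j * P $ j $ i) = stationary P i"
proof -
  have fixed: "p * (1 - a) + (1 - p) * b = p" "p * a + (1 - p) * (1 - b) = 1 - p"
    if "p * (a + b) = b" for p a b :: real
  proof -
    have "p * a + p * b = b" using that by (simp only: distrib_left)
    then show "p * (1 - a) + (1 - p) * b = p" "p * a + (1 - p) * (1 - b) = 1 - p"
      unfolding right_diff_distrib left_diff_distrib mult_1 mult_1_right by linarith+
  qed
  have diagonal: "P $ 0 $ 0 = 1 - P $ 0 $ 1" "P $ 1 $ 1 = 1 - P $ 1 $ 0"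
    using P_row[of 0] P_row[of 1] by linarith+
  have stat: "stationary P 0 = P $ 1 $ 0 / (P $ 0 $ 1 + P $ 1 $ 0)"
    "stationary P 1 = 1 - P $ 1 $ 0 / (P $ 0 $ 1 + P $ 1 $ 0)"
    by (simp_all add: stationary_def Let_def)
  have "y / x * x = y" if "0 < x" for x y :: real
    using that by simp
  from fixed[OF this[OF switch]] have "\<forall>i. (\<Sum>j\<in>UNIV. stationary P j * P $ j $ i) = stationary P i"
    unfolding forall_2_iff sum_2 stat diagonal by (rule conjI)
  then show ?thesis by (rule spec)
qed

lemma prob_value:
  assumes "u \<in> tree k"
  shows "prob (cylinder k {u} (\<lambda>_. i)) = stationary P i"
  using assms
proof (induction u arbitrary: i)
  case Nil
  show ?case by (subst prob_cylinder_closed) auto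
next
  case (Cons c u)
  then have u: "u \<in> tree k" by simp
  have "prob (cylinder k {c # u} (\<lambda>_. i))
      = (\<Sum>z\<in>(\<Pi>\<^sub>E w\<in>{()}. UNIV). prob (cylinder k {c # u} (\<lambda>_. i) \<inter> cylinder k {u} (\<lambda>_. z ())))"
    using prob_partition[of "cylinder k {c # u} (\<lambda>_. i)" "{()}" "\<lambda>_. u" "\<lambda>_. ()"] Cons
    by (simp add: sets_cylinder)
  also have "\<dots> = (\<Sum>j\<in>UNIV. prob (cylinder k {c # u} (\<lambda>_. i) \<inter> cylinder k {u} (\<lambda>_. j)))"
    by (rule sum.reindex_bij_witness[where i = "\<lambda>j. \<lambda>_\<in>{()}. j" and j = "\<lambda>z. z ()"])
      (auto simp: fun_eq_iff)
  also have "\<dots> = (\<Sum>j\<in>UNIV. stationary P j * P $ j $ i)"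
  proof (intro sum.cong refl)
    fix j
    define x where "x = (\<lambda>_. j)(c # u := i)"
    have "cylinder k {c # u} (\<lambda>_. i) \<inter> cylinder k {u} (\<lambda>_. j) = cylinder k ({u} \<union> {c # u}) x"
      by (auto simp: cylinder_def x_def)
    also have "prob \<dots> = prob (cylinder k {u} x) * (\<Prod>v\<in>{c # u}. P $ x (tl v) $ x v)"
    proof (rule prob_markov[where S = "ancestors u"])
      show "ancestors u \<inter> {c # u} = {}"
        using length_ancestors[of "c # u" u] by auto
    qed (use Cons.prems u in \<open>simp_all add: finite_ancestors Nil_in_ancestors self_in_ancestors
        ancestors_subset ancestors_closed\<close>)
    also have "cylinder k {u} x = cylinder k {u} (\<lambda>_. j)"
      by (rule cylinder_cong) (simp add: x_def)
    finally show "prob (cylinder k {c # u} (\<lambda>_. i) \<inter> cylinder k {u} (\<lambda>_. j)) = stationary P j * P $ j $ i"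
      using Cons.IH[OF u, of j] by (simp add: x_def)
  qed
  also have "\<dots> = stationary P i"
    by (rule stationary_fixed)
  finally show ?case .
qed

lemma prob_markov_levels:
  assumes u: "u \<in> tree k" and "d \<le> D"
  shows "prob (cylinder k (insert u (\<Union>d'\<in>{d..D}. descendants k d' u)) x)
     = prob (cylinder k (insert u (descendants k d u)) x)
       * (\<Prod>v\<in>(\<Union>d'\<in>{d<..D}. descendants k d' u). P $ x (tl v) $ x v)"
proof -
  let ?S = "ancestors u \<union> (\<Union>d'\<in>{..d}. descendants k d' u)"
  let ?N = "\<Union>d'\<in>{d<..D}. descendants k d' u"
  let ?F = "insert u (descendants k d u)"
  have parent: "tl v \<in> descendants k (d' - 1) u" if "v \<in> descendants k d' u" "0 < d'" for v d'
    using tl_descendants[of v k "d' - 1" u] that by simp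
  have "prob (cylinder k (?F \<union> ?N) x) = prob (cylinder k ?F x) * (\<Prod>v\<in>?N. P $ x (tl v) $ x v)"
  proof (rule prob_markov[where S = ?S])
    show "v \<in> ?S" if "c # v \<in> ?S" for c v
    proof (cases "c # v \<in> ancestors u")
      case True
      then show ?thesis by (blast intro: ancestors_closed)
    next
      case False
      with that obtain d' where d': "d' \<le> d" "c # v \<in> descendants k d' u" by blast
      moreover have "d' \<noteq> 0"
      proof
        assume "d' = 0"
        with d' have "c # v = u" by (simp add: descendants_0)
        with False self_in_ancestors[of u] show False by simp
      qed
      ultimately have "v \<in> descendants k (d' - 1) u" using parent[of "c # v" d'] by simp
      moreover have "d' - 1 \<in> {..d}" using d'(1) by simp
      ultimately show ?thesis by blast
    qed
    have "length v \<le> d + length u" if "v \<in> ?S" for v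
      using that length_ancestors[of v u] length_descendants[of v k _ u] by fastforce
    moreover have "d + length u < length v" if "v \<in> ?N" for v
      using that length_descendants[of v k _ u] by fastforce
    ultimately show "?S \<inter> ?N = {}" by (meson disjoint_iff not_le)
    show "tl v \<in> ?F \<union> ?N" if v: "v \<in> ?N" for v
    proof -
      from v obtain d' where d': "d < d'" "d' \<le> D" "v \<in> descendants k d' u" by auto
      then have tl: "tl v \<in> descendants k (d' - 1) u" by (intro parent) auto
      have "d' - 1 = d \<or> d' - 1 \<in> {d<..D}" using d'(1,2) by auto
      with tl show ?thesis by blast
    qed
    show "?F \<subseteq> ?S" using self_in_ancestors by auto
  qed (simp_all add: finite_ancestors Nil_in_ancestors UN_subset_iff
      ancestors_subset[OF u] descendants_subset[OF u])
  moreover have "{d..D} = insert d {d<..D}"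
    using \<open>d \<le> D\<close> by auto
  then have "?F \<union> ?N = insert u (\<Union>d'\<in>{d..D}. descendants k d' u)"
    by simp
  ultimately show ?thesis by simp
qed

text \<open>
  Given the value of any node \<open>u\<close>, the level \<open>n\<close> below \<open>u\<close> has the law \<open>level_law\<close>: in the induction the
  values on level \<open>n\<close> are summed over, and the bottom-up recursion for \<open>level_law\<close> appears.
\<close>
proposition prob_level:
  assumes u: "u \<in> tree k"
  shows "prob (cylinder k (insert u (descendants k n u)) x)
     = prob (cylinder k {u} x) * level_law k P n (x u) (\<lambda>w. x (w @ u))"
proof (induction n arbitrary: x)
  case 0
  show ?case by (simp add: descendants_0)
next
  case (Suc n)
  let ?D = "\<lambda>n. descendants k n u"
  define y where "y = (\<lambda>z v. if v \<in> ?D n then z (relative_path u v) else x v)"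
  let ?A = "cylinder k (insert u (?D (Suc n))) x"
  have "prob ?A = (\<Sum>z\<in>level_configs k n. prob (?A \<inter> cylinder k (?D n) (\<lambda>v. z (relative_path u v))))"
    unfolding level_configs_def descendants_eq[of k n]
  proof (rule prob_partition)
    show "?A \<in> sets (configs k)"
      by (rule sets_cylinder) (simp_all add: u descendants_subset)
    show "(\<lambda>w. w @ u) ` level k n \<subseteq> tree k"
      using descendants_subset[OF u] by (simp flip: descendants_eq)
  qed simp_all
  also have "\<dots> = (\<Sum>z\<in>level_configs k n. prob (cylinder k {u} x) *
      (level_law k P n (x u) z * (\<Prod>w\<in>level k (Suc n). P $ z (tl w) $ x (w @ u))))"
  proof (intro sum.cong refl)
    fix z
    show "prob (?A \<inter> cylinder k (?D n) (\<lambda>v. z (relative_path u v))) = prob (cylinder k {u} x) *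
      (level_law k P n (x u) z * (\<Prod>w\<in>level k (Suc n). P $ z (tl w) $ x (w @ u)))"
    \<comment> \<open>Level 0 below \<open>u\<close> is \<open>u\<close> itself, so there \<open>z\<close> may contradict the prescribed value \<open>x u\<close>.\<close>
    proof (cases "n = 0 \<and> z [] \<noteq> x u")
      case True
      then have "?A \<inter> cylinder k (?D n) (\<lambda>v. z (relative_path u v)) = {}"
        using relative_path_append[of u "[]"] by (auto simp: cylinder_def descendants_0)
      with True show ?thesis by (simp add: level_law.simps(1))
    next
      case False
      then have yu: "y z u = x u"
        using length_descendants[of u k n u] relative_path_append[of u "[]"] by (auto simp: y_def)
      have y_level: "y z (w @ u) = z w" if "w \<in> level k n" for w
        using that by (simp add: y_def descendants_eq)
      have y_Suc: "y z v = x v" if "v \<in> ?D (Suc n)" for v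
        using length_descendants[OF that] length_descendants[of v k n u] by (auto simp: y_def)
      have "?A \<inter> cylinder k (?D n) (\<lambda>v. z (relative_path u v))
          = cylinder k (insert u (\<Union>d'\<in>{n..Suc n}. ?D d')) (y z)"
      proof -
        have "?A = cylinder k (insert u (?D (Suc n))) (y z)"
          by (rule cylinder_cong) (use yu y_Suc in auto)
        moreover have "cylinder k (?D n) (\<lambda>v. z (relative_path u v)) = cylinder k (?D n) (y z)"
          by (rule cylinder_cong) (simp add: y_def)
        moreover have "insert u (\<Union>d'\<in>{n..Suc n}. ?D d') = insert u (?D (Suc n)) \<union> ?D n"
          by (simp add: atLeastAtMostSuc_conv)
        ultimately show ?thesis by (simp only: cylinder_Un)
      qed
      also have "prob \<dots> = prob (cylinder k (insert u (?D n)) (y z))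
          * (\<Prod>v\<in>(\<Union>d'\<in>{n<..Suc n}. ?D d'). P $ y z (tl v) $ y z v)"
        by (rule prob_markov_levels) (use u in auto)
      also have "(\<Union>d'\<in>{n<..Suc n}. ?D d') = (\<lambda>w. w @ u) ` level k (Suc n)"
      proof -
        have "{n<..Suc n} = {Suc n}" by auto
        then show ?thesis by (simp add: descendants_eq)
      qed
      also have "(\<Prod>v\<in>(\<lambda>w. w @ u) ` level k (Suc n). P $ y z (tl v) $ y z v)
          = (\<Prod>w\<in>level k (Suc n). P $ z (tl w) $ x (w @ u))"
      proof (subst prod.reindex)
        show "(\<Prod>w\<in>level k (Suc n). ((\<lambda>v. P $ y z (tl v) $ y z v) \<circ> (\<lambda>w. w @ u)) w)
          = (\<Prod>w\<in>level k (Suc n). P $ z (tl w) $ x (w @ u))"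
        proof (intro prod.cong refl)
          fix w assume w: "w \<in> level k (Suc n)"
          then have "w \<noteq> []" "tl w \<in> level k n" by (cases w; auto simp: level_def)+
          then show "((\<lambda>v. P $ y z (tl v) $ y z v) \<circ> (\<lambda>w. w @ u)) w = P $ z (tl w) $ x (w @ u)"
            using y_level[of "tl w"] y_Suc[of "w @ u"] w by (simp add: descendants_eq)
        qed
      qed (simp add: inj_on_def)
      also have "prob (cylinder k (insert u (?D n)) (y z))
          = prob (cylinder k {u} x) * level_law k P n (x u) z"
      proof -
        have "cylinder k {u} (y z) = cylinder k {u} x" by (rule cylinder_cong) (simp add: yu)
        moreover have "level_law k P n i (\<lambda>w. y z (w @ u)) = level_law k P n i z" for i
          by (rule level_law_cong) (rule y_level)
        ultimately show ?thesis unfolding Suc.IH yu by simp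
      qed
      finally show ?thesis by (simp add: mult.assoc)
    qed
  qed
  finally show ?case
    by (simp add: level_law_step[of n] sum_distrib_left)
qed

end

section \<open>Tail events and the posterior\<close>

abbreviation levels_between :: "nat \<Rightarrow> nat list \<Rightarrow> nat \<Rightarrow> nat \<Rightarrow> nat list set" where
  "levels_between k u d D \<equiv> (\<Union>d'\<in>{d..D}. descendants k d' u)"

abbreviation levels_from :: "nat \<Rightarrow> nat list \<Rightarrow> nat \<Rightarrow> nat list set" where
  "levels_from k u d \<equiv> (\<Union>d'\<in>{d..}. descendants k d' u)"

lemma cylinder_disjoint:
  assumes "v \<in> S" "v \<in> T" "y v \<noteq> z v"
  shows "cylinder k S y \<inter> cylinder k T z = {}"
proof -
  have "\<phi> v = y v" if "\<phi> \<in> cylinder k S y" for \<phi>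
    using that assms(1) unfolding cylinder_def by blast
  moreover have "\<phi> v = z v" if "\<phi> \<in> cylinder k T z" for \<phi>
    using that assms(2) unfolding cylinder_def by blast
  ultimately have "\<phi> \<notin> cylinder k T z" if "\<phi> \<in> cylinder k S y" for \<phi>
    using assms(3) that by force
  then show ?thesis by blast
qed

text \<open>
  An intersection-stable generator of the events observable on the levels from \<open>d\<close> on. Only cylinders
  over whole stretches of levels, beginning with level \<open>d\<close>, are used, because for these the Markov
  property applies directly: the parent of every further node is among the prescribed nodes. For
  \<open>D < d\<close> the cylinder is the whole space.
\<close>
definition level_cylinders :: "nat \<Rightarrow> nat list \<Rightarrow> nat \<Rightarrow> (nat list \<Rightarrow> 2) set set" where
  "level_cylinders k u d = insert {} {cylinder k (levels_between k u d D) y | D y. True}"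

lemma level_cylinders_cases:
  assumes "C \<in> level_cylinders k u d"
  obtains "C = {}" | D y where "C = cylinder k (levels_between k u d D) y"
  using assms unfolding level_cylinders_def by blast

lemma empty_in_level_cylinders: "{} \<in> level_cylinders k u d"
  and cylinder_in_level_cylinders: "cylinder k (levels_between k u d D) y \<in> level_cylinders k u d"
  unfolding level_cylinders_def by blast+

lemma level_cylinders_subset: "level_cylinders k u d \<subseteq> Pow (space (configs k))"
proof
  fix C assume "C \<in> level_cylinders k u d"
  then show "C \<in> Pow (space (configs k))"
    by (cases rule: level_cylinders_cases) (simp_all add: cylinder_def)
qed

lemma level_cylinders_measurable:
  assumes "u \<in> tree k"
  shows "level_cylinders k u d \<subseteq> sets (configs k)"
proof -
  have "levels_between k u d D \<subseteq> tree k" for D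
    using descendants_subset[OF assms] by blast
  then have "cylinder k (levels_between k u d D) y \<in> sets (configs k)" for D y
    by (intro sets_cylinder) simp_all
  then show ?thesis by (blast elim: level_cylinders_cases)
qed

lemma Int_stable_level_cylinders: "Int_stable (level_cylinders k u d)"
proof -
  have meet: "cylinder k S y \<inter> cylinder k T z = {} \<or> cylinder k S y \<inter> cylinder k T z = cylinder k T z"
    if "S \<subseteq> T" for S T y z
  proof (cases "\<forall>v\<in>S. y v = z v")
    case True
    then have "cylinder k S y \<inter> cylinder k T z = cylinder k S z \<inter> cylinder k T z"
      by (intro arg_cong[of _ _ "\<lambda>A. A \<inter> _"] cylinder_cong) simp
    also have "\<dots> = cylinder k (S \<union> T) z" by (rule cylinder_Un[symmetric])
    also have "S \<union> T = T" using that by (rule Un_absorb1)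
    finally have "cylinder k S y \<inter> cylinder k T z = cylinder k T z" .
    then show ?thesis by (rule disjI2)
  next
    case False
    then have "\<exists>v\<in>S. y v \<noteq> z v" by simp
    then obtain v where v: "v \<in> S" "y v \<noteq> z v" by (elim bexE)
    have "v \<in> T" using that v(1) by (rule subsetD)
    with v have "cylinder k S y \<inter> cylinder k T z = {}" by (intro cylinder_disjoint)
    then show ?thesis by (rule disjI1)
  qed
  have "cylinder k (levels_between k u d D) y \<inter> cylinder k (levels_between k u d D') z
      \<in> level_cylinders k u d" for D D' y z
  proof (cases "D \<le> D'")
    case True
    then have "levels_between k u d D \<subseteq> levels_between k u d D'" by (intro UN_mono) auto
    from meet[OF this, of y z] show ?thesis
      using empty_in_level_cylinders cylinder_in_level_cylinders by metis
  next
    case False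
    then have "levels_between k u d D' \<subseteq> levels_between k u d D" by (intro UN_mono) auto
    from meet[OF this, of z y] show ?thesis
      using empty_in_level_cylinders cylinder_in_level_cylinders by (metis Int_commute)
  qed
  then have "C \<inter> C' \<in> level_cylinders k u d"
    if "C \<in> level_cylinders k u d" "C' \<in> level_cylinders k u d" for C C'
    using that by (elim level_cylinders_cases) (simp_all add: empty_in_level_cylinders)
  then show ?thesis by (simp add: Int_stable_def)
qed

lemma sigma_gen_level_cylinders:
  "sigma_gen k (levels_from k u d) \<subseteq> sigma_sets (space (configs k)) (level_cylinders k u d)"
proof -
  interpret S: sigma_algebra "space (configs k)" "sigma_sets (space (configs k)) (level_cylinders k u d)"
    by (rule sigma_algebra_sigma_sets[OF level_cylinders_subset])
  have "(\<lambda>\<phi>. \<phi> v) -` B \<inter> space (configs k)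
      \<in> sigma_sets (space (configs k)) (level_cylinders k u d)" if v: "v \<in> levels_from k u d" for v B
  proof -
    from v obtain D where D: "d \<le> D" "v \<in> descendants k D u" by auto
    let ?S = "levels_between k u d D"
    have vS: "v \<in> ?S" using D by auto
    let ?Y = "{y \<in> (\<Pi>\<^sub>E w\<in>?S. UNIV). y v \<in> B}"
    have "(\<lambda>\<phi>. \<phi> v) -` B \<inter> space (configs k) = (\<Union>y\<in>?Y. cylinder k ?S y)"
    proof (intro subset_antisym subsetI)
      fix \<phi> assume "\<phi> \<in> (\<lambda>\<phi>. \<phi> v) -` B \<inter> space (configs k)"
      then have "\<phi> \<in> cylinder k ?S (restrict \<phi> ?S)" "restrict \<phi> ?S \<in> ?Y"
        using vS by (auto simp: cylinder_def)
      then show "\<phi> \<in> (\<Union>y\<in>?Y. cylinder k ?S y)" by blast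
    next
      fix \<phi> assume "\<phi> \<in> (\<Union>y\<in>?Y. cylinder k ?S y)"
      then obtain y where "y v \<in> B" "\<phi> \<in> cylinder k ?S y" by blast
      moreover from this(2) have "\<phi> \<in> space (configs k)" "\<phi> v = y v"
        using vS unfolding cylinder_def by blast+
      ultimately show "\<phi> \<in> (\<lambda>\<phi>. \<phi> v) -` B \<inter> space (configs k)" by simp
    qed
    moreover have "finite ?Y"
      by (rule finite_subset[of _ "\<Pi>\<^sub>E w\<in>?S. UNIV"]) (auto intro!: finite_PiE)
    moreover have "cylinder k ?S y \<in> sigma_sets (space (configs k)) (level_cylinders k u d)" for y
      by (rule sigma_sets.Basic) (rule cylinder_in_level_cylinders)
    ultimately show ?thesis by (simp add: S.finite_UN)
  qed
  then show ?thesis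
    unfolding sigma_gen_def by (intro S.sigma_sets_subset) blast
qed

context stationary_broadcast
begin

text \<open>
  Given the values on level \<open>d\<close> below \<open>u\<close>, the levels from \<open>d\<close> on do not depend on the value of \<open>u\<close>. The
  equality of the two conditional probabilities is stated with denominators cleared. In this form it
  is additive in \<open>T\<close>, which allows Dynkin's argument; on the generating cylinders both sides
  carry the same product over the edges below level \<open>d\<close>, as none of these edges starts at \<open>u\<close>.
\<close>
lemma tail_event_markov:
  fixes x :: "nat list \<Rightarrow> 2"
  assumes u: "u \<in> tree k" and d: "1 \<le> d" and T: "T \<in> sigma_gen k (levels_from k u d)"
  defines "B \<equiv> \<lambda>i. cylinder k (insert u (descendants k d u)) (x(u := i))"
  shows "prob (T \<inter> B 0) * prob (B 1) = prob (T \<inter> B 1) * prob (B 0)"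
proof -
  have B: "B i \<in> sets (configs k)" for i
    unfolding B_def by (rule sets_cylinder) (simp_all add: u descendants_subset)
  have u_notin: "u \<notin> descendants k d' u" if "1 \<le> d'" for d'
    using length_descendants[of u k d' u] that by auto
  have sub: "sigma_sets (space (configs k)) (level_cylinders k u d) \<subseteq> sets (configs k)"
    by (rule sets.sigma_sets_subset[OF level_cylinders_measurable[OF u]])
  have "T \<in> sigma_sets (space (configs k)) (level_cylinders k u d)"
    using T sigma_gen_level_cylinders by blast
  with Int_stable_level_cylinders level_cylinders_subset show ?thesis
  proof (induction rule: sigma_sets_induct_disjoint)
    case (basic C)
    show ?case
    proof (cases "C \<inter> B 0 = {} \<and> C \<inter> B 1 = {}")
      case False
      then have "C \<noteq> {}" by blast
      with basic obtain D y where C: "C = cylinder k (levels_between k u d D) y"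
        by (blast elim: level_cylinders_cases)
      show ?thesis
      proof (cases "d \<le> D")
        case True
        have agree: "y v = x v" if v: "v \<in> descendants k d u" for v
        proof -
          from False obtain \<phi> i where \<phi>: "\<phi> \<in> C" "\<phi> \<in> B i" by blast
          have "v \<noteq> u" using v u_notin[OF d] by blast
          have "d \<in> {d..D}" using True by simp
          with v have "v \<in> levels_between k u d D" by blast
          with \<phi>(1) have "\<phi> v = y v" unfolding C cylinder_def by blast
          moreover have "\<phi> v = (x(u := i)) v"
            using \<phi>(2) v unfolding B_def cylinder_def by blast
          ultimately show ?thesis using \<open>v \<noteq> u\<close> by simp
        qed
        define N where "N = (\<Union>d'\<in>{d<..D}. descendants k d' u)"
        have u_between: "u \<notin> levels_between k u d D" using u_notin d by auto
        have "prob (C \<inter> B i) = prob (B i) * (\<Prod>v\<in>N. P $ y (tl v) $ y v)" for i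
        proof -
          have "B i = cylinder k (insert u (descendants k d u)) (y(u := i))"
            unfolding B_def using agree by (intro cylinder_cong) (simp, metis)
          moreover have "C = cylinder k (levels_between k u d D) (y(u := i))"
            unfolding C by (rule cylinder_cong) (use u_between in auto)
          moreover have "levels_between k u d D \<union> insert u (descendants k d u)
              = insert u (levels_between k u d D)"
          proof -
            have "d \<in> {d..D}" using True by simp
            then show ?thesis by blast
          qed
          ultimately have "prob (C \<inter> B i) = prob (B i) * (\<Prod>v\<in>N. P $ (y(u := i)) (tl v) $ (y(u := i)) v)"
            using prob_markov_levels[OF u True, of "y(u := i)"]
            by (simp only: N_def flip: cylinder_Un)
          moreover have "tl v \<noteq> u \<and> v \<noteq> u" if "v \<in> N" for v
          proof -
            from that obtain d' where "d < d'" "v \<in> descendants k d' u" by (auto simp: N_def)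
            then show ?thesis using d length_descendants[of v k d' u] by auto
          qed
          ultimately show ?thesis by simp
        qed
        then show ?thesis by simp
      next
        case False
        then have "C = space (configs k)" by (simp add: C cylinder_def)
        then have "C \<inter> B i = B i" for i
          using sets.sets_into_space[OF B[of i]] by (simp add: Int_absorb1)
        then show ?thesis by (simp add: mult.commute)
      qed
    qed auto
  next
    case empty
    show ?case by simp
  next
    case (compl C)
    have diff: "prob ((space (configs k) - C) \<inter> B i) = prob (B i) - prob (C \<inter> B i)" for i
    proof -
      have "(space (configs k) - C) \<inter> B i = B i - C \<inter> B i"
        using sets.sets_into_space[OF B] by blast
      moreover have "C \<in> sets (configs k)" using compl sub by blast
      ultimately show ?thesis
        using B by (simp add: brw.finite_measure_Diff)
    qed
    show ?case unfolding diff left_diff_distrib compl(2) by (simp add: mult.commute)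
  next
    case (union C)
    have "(\<lambda>n. prob (C n \<inter> B i)) sums prob ((\<Union>n. C n) \<inter> B i)" for i
    proof -
      have "C n \<in> sets (configs k)" for n using union(2) sub by blast
      then have "range (\<lambda>n. C n \<inter> B i) \<subseteq> sets (brw k P)" using B by (simp add: image_subset_iff)
      moreover have "disjoint_family (\<lambda>n. C n \<inter> B i)"
        using union(1) unfolding disjoint_family_on_def by blast
      ultimately have "(\<lambda>n. prob (C n \<inter> B i)) sums prob (\<Union>n. C n \<inter> B i)"
        by (rule brw.finite_measure_UNION)
      then show ?thesis by simp
    qed
    then have "(\<lambda>n. prob (C n \<inter> B 0) * prob (B 1)) sums (prob ((\<Union>n. C n) \<inter> B 0) * prob (B 1))"
      "(\<lambda>n. prob (C n \<inter> B 1) * prob (B 0)) sums (prob ((\<Union>n. C n) \<inter> B 1) * prob (B 0))"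
      by (auto intro: sums_mult2)
    then show ?case unfolding union(3) by (rule sums_unique2)
  qed
qed

abbreviation value_event :: "nat list \<Rightarrow> 2 \<Rightarrow> (nat list \<Rightarrow> 2) set" where
  "value_event u i \<equiv> cylinder k {u} (\<lambda>_. i)"

text \<open>
  An event observable from level \<open>n\<close> on has a conditional probability given the values on level \<open>n\<close>
  which is the same function for both values of \<open>u\<close>. Integrating this function, with values between 0
  and 1, against the two level laws gives results that differ at most by their \<open>L\<^sup>1\<close> distance.
\<close>
proposition tail_event_dependence:
  assumes u: "u \<in> tree k" and n: "1 \<le> n" and T: "T \<in> sigma_gen k (levels_from k u n)"
    and pos: "\<And>i x. 0 < level_law k P n i x"
  shows "\<bar>prob (T \<inter> value_event u 0) * prob (value_event u 1)
          - prob (T \<inter> value_event u 1) * prob (value_event u 0)\<bar>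
    \<le> (\<Sum>x\<in>level_configs k n. \<bar>level_law k P n 0 x - level_law k P n 1 x\<bar>)"
proof -
  define a where "a = (\<lambda>i. prob (value_event u i))"
  define B where "B = (\<lambda>z i. cylinder k (insert u (descendants k n u)) ((\<lambda>v. z (relative_path u v))(u := i)))"
  have u_notin: "u \<notin> descendants k n u" using length_descendants[of u k n u] n by auto
  have T_sets: "T \<in> sets (configs k)"
    using T sigma_gen_subset[of "levels_from k u n" k] descendants_subset[OF u] by blast
  have a01: "0 \<le> a i" "a i \<le> 1" for i by (simp_all add: a_def)
  have B_sets: "B z i \<in> sets (configs k)" for z i
    unfolding B_def by (rule sets_cylinder) (simp_all add: u descendants_subset)
  have prob_B: "prob (B z i) = a i * level_law k P n i z" for z i
  proof -
    have "cylinder k {u} ((\<lambda>v. z (relative_path u v))(u := i)) = value_event u i"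
      by (rule cylinder_cong) simp
    moreover have "level_law k P n i (\<lambda>w. ((\<lambda>v. z (relative_path u v))(u := i)) (w @ u)) = level_law k P n i z"
      by (rule level_law_cong) (use n in \<open>auto simp: level_def\<close>)
    ultimately show ?thesis
      unfolding B_def prob_level[OF u] a_def by simp
  qed
  have split: "prob (T \<inter> value_event u i) = (\<Sum>z\<in>level_configs k n. prob (T \<inter> B z i))" for i
  proof -
    have "prob (T \<inter> value_event u i) = (\<Sum>z\<in>level_configs k n.
        prob (T \<inter> value_event u i \<inter> cylinder k (descendants k n u) (\<lambda>v. z (relative_path u v))))"
      unfolding level_configs_def descendants_eq[of k n]
    proof (rule prob_partition)
      show "T \<inter> value_event u i \<in> sets (configs k)"
        using u by (intro sets.Int T_sets sets_cylinder) auto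
      show "(\<lambda>w. w @ u) ` level k n \<subseteq> tree k"
        using descendants_subset[OF u] by (simp flip: descendants_eq)
    qed simp_all
    moreover have "value_event u i \<inter> cylinder k (descendants k n u) (\<lambda>v. z (relative_path u v)) = B z i" for z
      using u_notin by (auto simp: B_def cylinder_def)
    ultimately show ?thesis by (simp add: Int_assoc)
  qed
  have pointwise: "\<bar>prob (T \<inter> B z 0) * a 1 - prob (T \<inter> B z 1) * a 0\<bar>
      \<le> \<bar>level_law k P n 0 z - level_law k P n 1 z\<bar>" for z
  proof -
    define p q where "p = level_law k P n 0 z" and "q = level_law k P n 1 z"
    define b c where "b = prob (T \<inter> B z 0)" and "c = prob (T \<inter> B z 1)"
    have pq: "0 < p" "0 < q" using pos by (simp_all add: p_def q_def)
    have markov: "b * (a 1 * q) = c * (a 0 * p)"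
      using tail_event_markov[OF u n T, of "\<lambda>v. z (relative_path u v)"] prob_B
      by (simp add: b_def c_def p_def q_def B_def)
    have bound: "b \<le> a 0 * p" "c \<le> a 1 * q" "0 \<le> b" "0 \<le> c"
      using brw.finite_measure_mono[of "T \<inter> B z 0" "B z 0"] brw.finite_measure_mono[of "T \<inter> B z 1" "B z 1"]
      by (simp_all add: B_sets b_def c_def p_def q_def prob_B)
    \<comment> \<open>Here \<open>b / p\<close> is \<open>a 0\<close> times the common conditional probability of \<open>T\<close>.\<close>
    have "b * a 1 - c * a 0 = (b / p) * a 1 * (p - q)"
    proof -
      have "(b * a 1 - c * a 0) * p = b * a 1 * p - b * a 1 * q"
        using markov by (simp add: algebra_simps)
      then show ?thesis using pq by (simp add: field_simps)
    qed
    moreover have "0 \<le> b / p * a 1" "b / p * a 1 \<le> 1"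
    proof -
      have "a 0 * p \<le> 1 * p" using pq by (intro mult_right_mono a01) simp
      with bound(1) have "b \<le> 1 * p" by (rule order_trans)
      with pq have "b / p \<le> 1" by (simp add: pos_divide_le_eq)
      then show "b / p * a 1 \<le> 1" by (rule mult_le_one) (rule a01)+
      show "0 \<le> b / p * a 1" using bound(3) pq a01[of 1] by simp
    qed
    ultimately have "\<bar>b * a 1 - c * a 0\<bar> \<le> 1 * \<bar>p - q\<bar>"
      by (simp only: abs_mult) (intro mult_right_mono, auto)
    then show ?thesis by (simp add: b_def c_def p_def q_def)
  qed
  have "prob (T \<inter> value_event u 0) * a 1 - prob (T \<inter> value_event u 1) * a 0
    = (\<Sum>z\<in>level_configs k n. prob (T \<inter> B z 0) * a 1 - prob (T \<inter> B z 1) * a 0)"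
    unfolding split by (simp add: sum_subtractf sum_distrib_right)
  also have "\<bar>\<dots>\<bar> \<le> (\<Sum>z\<in>level_configs k n. \<bar>level_law k P n 0 z - level_law k P n 1 z\<bar>)"
    by (rule order_trans[OF sum_abs sum_mono]) (rule pointwise)
  finally show ?thesis unfolding a_def .
qed

lemma prob_split_value:
  assumes u: "u \<in> tree k" and A: "A \<in> sets (configs k)"
  shows "prob A = prob (A \<inter> value_event u 0) + prob (A \<inter> value_event u 1)"
proof -
  have "A = (A \<inter> value_event u 0) \<union> (A \<inter> value_event u 1)"
    using sets.sets_into_space[OF A] UNIV_2_eq by (auto simp: cylinder_def)
  moreover have "prob ((A \<inter> value_event u 0) \<union> (A \<inter> value_event u 1))
      = prob (A \<inter> value_event u 0) + prob (A \<inter> value_event u 1)"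
  proof (rule brw.finite_measure_Union)
    show "(A \<inter> value_event u 0) \<inter> (A \<inter> value_event u 1) = {}"
      by (auto simp: cylinder_def)
  qed (use u A in \<open>auto intro!: sets.Int sets_cylinder\<close>)
  ultimately show ?thesis by simp
qed

text \<open>
  The node has one of the two values, so the hypothesis says that its value is independent of the
  tail, and the constant \<open>\<pi>\<^sub>0\<close> has the integrals that characterise the conditional expectation.
\<close>
lemma posterior_const:
  assumes u: "u \<in> tree k"
    and indep: "\<And>T. T \<in> sets (tail k u) \<Longrightarrow>
      prob (T \<inter> value_event u 0) * prob (value_event u 1)
        = prob (T \<inter> value_event u 1) * prob (value_event u 0)"
  shows "AE \<phi> in brw k P. posterior k P u \<phi> = stationary P 0"
proof -
  have sub: "subalgebra (brw k P) (tail k u)" by (rule subalgebra_tail[OF u])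
  interpret finite_measure_subalgebra "brw k P" "tail k u"
    by unfold_locales (rule sub)
  have event: "{\<phi> \<in> space (brw k P). \<phi> u = 0} = value_event u 0"
    by (auto simp: cylinder_def)
  have E: "value_event u i \<in> sets (configs k)" for i
    by (rule sets_cylinder) (use u in auto)
  have "AE \<phi> in brw k P. real_cond_exp (brw k P) (tail k u) (indicator (value_event u 0)) \<phi>
      = stationary P 0"
  proof (rule real_cond_exp_charact)
    fix T assume T: "T \<in> sets (tail k u)"
    then have T': "T \<in> sets (configs k)" using sub by (auto simp: subalgebra_def)
    have total: "prob (value_event u 0) + prob (value_event u 1) = 1"
      by (simp add: prob_value[OF u] stationary_def Let_def)
    have "prob (T \<inter> value_event u 0) = prob (T \<inter> value_event u 0) * (prob (value_event u 0) + prob (value_event u 1))"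
      by (simp add: total)
    also have "\<dots> = (prob (T \<inter> value_event u 0) + prob (T \<inter> value_event u 1)) * prob (value_event u 0)"
      using indep[OF T] by (simp only: distrib_left distrib_right)
    also have "\<dots> = prob T * stationary P 0"
      by (simp add: prob_split_value[OF u T'] prob_value[OF u])
    finally have prob_T: "prob (T \<inter> value_event u 0) = prob T * stationary P 0" .
    have "(\<integral>\<phi>\<in>T. indicator (value_event u 0) \<phi> \<partial>brw k P) = prob (T \<inter> value_event u 0)"
      using T' E by (simp add: set_lebesgue_integral_def flip: indicator_inter_arith)
    moreover have "(\<integral>\<phi>\<in>T. stationary P 0 \<partial>brw k P) = prob T * stationary P 0"
      using T' by (simp add: set_lebesgue_integral_def)
    ultimately show "(\<integral>\<phi>\<in>T. indicator (value_event u 0) \<phi> \<partial>brw k P) = (\<integral>\<phi>\<in>T. stationary P 0 \<partial>brw k P)"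
      using prob_T by simp
  qed (use E in \<open>auto intro!: integrable_real_indicator simp: brw.emeasure_eq_measure\<close>)
  then show ?thesis unfolding posterior_def event .
qed

end

section \<open>Impossibility of reconstruction\<close>

theorem theorem1:
  fixes k :: nat and P :: "real^2^2"
  assumes "k \<ge> 1"
    and "stochastic P"
    and "P $ 0 $ 1 + P $ 1 $ 0 > 0"
    and "\<not> (k = 1 \<and> P $ 0 $ 1 = 1 \<and> P $ 1 $ 0 = 1)"
    and "(sqrt (P $ 0 $ 0 * P $ 1 $ 1) - sqrt (P $ 0 $ 1 * P $ 1 $ 0))\<^sup>2 \<le> 1 / real k"
  shows "reconstruction_impossible k P"
proof -
  interpret stationary_broadcast k P
    by unfold_locales (use assms in auto)
  have "AE \<phi> in brw k P. posterior k P u \<phi> = stationary P 0" if u: "u \<in> tree k" for u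
  proof (rule posterior_const[OF u])
    fix T assume T: "T \<in> sets (tail k u)"
    show "prob (T \<inter> value_event u 0) * prob (value_event u 1)
        = prob (T \<inter> value_event u 1) * prob (value_event u 0)"
    proof (cases "P $ 0 $ 1 = 0 \<or> P $ 1 $ 0 = 0")
      case True
      have "stationary P 0 = 0 \<or> stationary P 1 = 0"
        using True assms(3) by (auto simp: stationary_def Let_def)
      then obtain i where i: "prob (value_event u i) = 0"
        using prob_value[OF u] by metis
      have "prob (T \<inter> value_event u i) \<le> prob (value_event u i)"
        by (rule brw.finite_measure_mono) (use u in \<open>auto intro: sets_cylinder\<close>)
      then have "prob (T \<inter> value_event u i) = 0"
        unfolding i by (intro antisym measure_nonneg)
      moreover have "i = 0 \<or> i = 1" using UNIV_2_eq by auto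
      ultimately show ?thesis using i by (elim disjE) auto
    next
      case False
      interpret subcritical_broadcast k P
      proof
        show off: "0 < P $ 0 $ 1" "0 < P $ 1 $ 0"
          using False P_nonneg[of 0 1] P_nonneg[of 1 0] by (simp_all add: less_le)
        show threshold: "real k * (sqrt (P $ 0 $ 0 * P $ 1 $ 1) - sqrt (P $ 0 $ 1 * P $ 1 $ 0))\<^sup>2 \<le> 1"
          using assms(1,5) by (simp add: field_simps)
        show "0 < P $ 0 $ 0 \<or> 0 < P $ 1 $ 1"
        proof (rule ccontr)
          assume "\<not> ?thesis"
          then have "P $ 0 $ 0 = 0" "P $ 1 $ 1 = 0"
            using P_nonneg[of 0 0] P_nonneg[of 1 1] by linarith+
          moreover from this have "P $ 0 $ 1 = 1" "P $ 1 $ 0 = 1"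
            using P_row[of 0] P_row[of 1] by simp_all
          ultimately have "k \<le> 1" "k \<noteq> 1"
            using threshold assms(4) by simp_all
          with assms(1) show False by simp
        qed
      qed
      have "\<bar>prob (T \<inter> value_event u 0) * prob (value_event u 1)
          - prob (T \<inter> value_event u 1) * prob (value_event u 0)\<bar> \<le> 0 + \<epsilon>" if \<epsilon>: "0 < \<epsilon>" for \<epsilon>
      proof -
        from level_laws_merge[OF \<epsilon>] obtain n where n: "2 \<le> n"
          "(\<Sum>x\<in>level_configs k n. \<bar>level_law k P n 0 x - level_law k P n 1 x\<bar>) \<le> \<epsilon>" .
        have "T \<in> sigma_gen k (levels_from k u n)"
          using T n(1) by (simp add: sets_tail)
        from tail_event_dependence[OF u _ this level_law_pos[OF n(1)]] n show ?thesis
          by simp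
      qed
      then have "\<bar>prob (T \<inter> value_event u 0) * prob (value_event u 1)
          - prob (T \<inter> value_event u 1) * prob (value_event u 0)\<bar> \<le> 0"
        by (rule field_le_epsilon)
      then show ?thesis by simp
    qed
  qed
  then show ?thesis
    unfolding reconstruction_impossible_def by blast
qed

end
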